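(* For all integers $1\le n<r$, $$|B_x(n,r)|\ \le\ 1+\sum_{i=1}^{n}\binom{n}{i}\left[\,2\binom{r+2^i-1}{r}\Big/ i!\;-\;\binom{r+2^{i-1}-1}{r}\Big/(i-1)!\,\right].$$
   Context: Let $I$ (left vertices) and $O$ (right vertices) be disjoint finite sets with $|I|=n$ and $|O|=r$. An $(n,r)$-bipartite graph is $G=(I\oplus O,E)$ with edge set $E\subseteq I\times O$. The connected domain $I_c(G)$ is the set of vertices of $I$ with nonzero degree in $G$. Two $(n,r)$-bipartite graphs $G_1=(I\oplus O,E_1)$ and $G_2=(I\oplus O,E_2)$ are left-set-labeled equivalent if there exist bijections $\alpha:I\to I$ and $\beta:O\to O$ such that for all $x\in I,y\in O$, $(x,y)\in E_1$ iff $(\alpha(x),\beta(y))\in E_2$, and moreover $I_c(G_1)=I_c(G_2)$. $B_x(n,r)$ denotes the set of equivalence classes of $(n,r)$-bipartite graphs under left-set-labeled equivalence. *)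

theory Defs
  imports Complex_Main
begin

text \<open>The vertex sets \<open>I\<close> (left) and \<open>J\<close> (right) are fixed, so a bipartite graph is given by its
  edge set. The right vertex set is called \<open>J\<close> because \<open>O\<close> is reserved for relation composition.\<close>

definition bipartite_graphs :: "'v set \<Rightarrow> 'v set \<Rightarrow> ('v \<times> 'v) set set" where
  "bipartite_graphs I J = {E. E \<subseteq> I \<times> J}"

definition left_degree :: "('v \<times> 'v) set \<Rightarrow> 'v \<Rightarrow> nat" where
  "left_degree E x = card {e \<in> E. fst e = x}"

definition connected_domain :: "'v set \<Rightarrow> ('v \<times> 'v) set \<Rightarrow> 'v set" where
  "connected_domain I E = {x \<in> I. left_degree E x \<noteq> 0}"

definition left_set_labeled_equivalent ::
    "'v set \<Rightarrow> 'v set \<Rightarrow> ('v \<times> 'v) set \<Rightarrow> ('v \<times> 'v) set \<Rightarrow> bool" where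
  "left_set_labeled_equivalent I J E1 E2 \<longleftrightarrow>
     (\<exists>\<alpha> \<beta>. bij_betw \<alpha> I I \<and> bij_betw \<beta> J J \<and>
        (\<forall>x\<in>I. \<forall>y\<in>J. (x, y) \<in> E1 \<longleftrightarrow> (\<alpha> x, \<beta> y) \<in> E2)) \<and>
     connected_domain I E1 = connected_domain I E2"

definition left_set_labeled_rel :: "'v set \<Rightarrow> 'v set \<Rightarrow> (('v \<times> 'v) set \<times> ('v \<times> 'v) set) set" where
  "left_set_labeled_rel I J =
     {(E1, E2). E1 \<in> bipartite_graphs I J \<and> E2 \<in> bipartite_graphs I J \<and>
        left_set_labeled_equivalent I J E1 E2}"

definition B_x :: "'v set \<Rightarrow> 'v set \<Rightarrow> ('v \<times> 'v) set set set" where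
  "B_x I J = bipartite_graphs I J // left_set_labeled_rel I J"

lemma left_set_labeled_equivalent_refl: "left_set_labeled_equivalent I J E E"
  unfolding left_set_labeled_equivalent_def
  by (intro conjI exI[of _ id]) auto

lemma left_set_labeled_equivalent_sym:
  assumes "left_set_labeled_equivalent I J E1 E2"
  shows "left_set_labeled_equivalent I J E2 E1"
proof -
  from assms obtain \<alpha> \<beta> where a: "bij_betw \<alpha> I I" and b: "bij_betw \<beta> J J"
    and e: "\<forall>x\<in>I. \<forall>y\<in>J. (x, y) \<in> E1 \<longleftrightarrow> (\<alpha> x, \<beta> y) \<in> E2"
    and c: "connected_domain I E1 = connected_domain I E2"
    unfolding left_set_labeled_equivalent_def by blast
  have "(x, y) \<in> E2 \<longleftrightarrow> (inv_into I \<alpha> x, inv_into J \<beta> y) \<in> E1" if "x \<in> I" "y \<in> J" for x y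
    using that e bij_betw_inv_into_right[OF a] bij_betw_inv_into_right[OF b]
      bij_betwE[OF bij_betw_inv_into[OF a]] bij_betwE[OF bij_betw_inv_into[OF b]] by metis
  then show ?thesis
    unfolding left_set_labeled_equivalent_def
    using bij_betw_inv_into[OF a] bij_betw_inv_into[OF b] c by blast
qed

lemma left_set_labeled_equivalent_trans:
  assumes "left_set_labeled_equivalent I J E1 E2" "left_set_labeled_equivalent I J E2 E3"
  shows "left_set_labeled_equivalent I J E1 E3"
proof -
  from assms(1) obtain \<alpha> \<beta> where a: "bij_betw \<alpha> I I" and b: "bij_betw \<beta> J J"
    and e: "\<forall>x\<in>I. \<forall>y\<in>J. (x, y) \<in> E1 \<longleftrightarrow> (\<alpha> x, \<beta> y) \<in> E2"
    and c: "connected_domain I E1 = connected_domain I E2"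
    unfolding left_set_labeled_equivalent_def by blast
  from assms(2) obtain \<gamma> \<delta> where a': "bij_betw \<gamma> I I" and b': "bij_betw \<delta> J J"
    and e': "\<forall>x\<in>I. \<forall>y\<in>J. (x, y) \<in> E2 \<longleftrightarrow> (\<gamma> x, \<delta> y) \<in> E3"
    and c': "connected_domain I E2 = connected_domain I E3"
    unfolding left_set_labeled_equivalent_def by blast
  have "\<forall>x\<in>I. \<forall>y\<in>J. (x, y) \<in> E1 \<longleftrightarrow> ((\<gamma> \<circ> \<alpha>) x, (\<delta> \<circ> \<beta>) y) \<in> E3"
    using e e' bij_betwE[OF a] bij_betwE[OF b] by simp
  then show ?thesis
    unfolding left_set_labeled_equivalent_def
    using bij_betw_trans[OF a a'] bij_betw_trans[OF b b'] c c' by blast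
qed

lemma equiv_left_set_labeled_rel: "equiv (bipartite_graphs I J) (left_set_labeled_rel I J)"
  by (rule equivI)
    (auto simp: left_set_labeled_rel_def refl_on_def
      intro!: symI transI left_set_labeled_equivalent_refl
      intro: left_set_labeled_equivalent_sym left_set_labeled_equivalent_trans)

end

theory Submission
  imports Defs "HOL-Combinatorics.Stirling" "HOL-Combinatorics.Orbits" "HOL-Library.FuncSet"
    "HOL-Library.Code_Binary_Nat"
begin

text \<open>
  Let \<open>U(i)\<close> be the number of isomorphism classes of bipartite graphs with \<open>i\<close> left and \<open>r\<close> right
  vertices. The classes with connected domain \<open>S\<close>, \<open>card S = i\<close>, number at most \<open>U(i) - U(i - 1)\<close>,
  since a graph in which some left vertex is isolated comes from a smaller left set. So it suffices
  that \<open>i! r! U(i)\<close> lies between \<open>pochhammer (2 ^ i) r\<close> and, for \<open>i < r\<close>, twice that number. By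
  Burnside it is the sum over pairs \<open>(\<sigma>, \<tau>)\<close> of permutations of the number of fixed graphs;
  \<open>\<sigma> = id\<close> alone contributes the Pochhammer symbol, which gives the lower bound.

  For the upper bound, a graph fixed by \<open>(\<sigma>, \<tau>)\<close> is determined by one neighbourhood per cycle of
  \<open>\<tau>\<close>, and at fixed points of \<open>\<tau>\<close> this neighbourhood is one of the \<open>a = 2 ^ c\<close> subsets invariant
  under \<open>\<sigma>\<close>, where \<open>c\<close> is the number of cycles of \<open>\<sigma>\<close>. Summing over \<open>\<tau>\<close> bounds the contribution of
  \<open>\<sigma>\<close> by a number \<open>K r\<close> with a two-step recurrence in \<open>r\<close>, and Stirling numbers count the \<open>\<sigma>\<close>
  with given \<open>c\<close>. As \<open>K (r + 1) \<le> (2 ^ i + r) K r\<close>, only \<open>r = i + 1\<close> matters. There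
  \<open>K r / pochhammer (2 ^ i) r\<close> is at most \<open>(2 ^ (c - i) + \<epsilon>) ^ r\<close> with \<open>\<epsilon>\<close> of order \<open>1 / i\<close>, which
  settles \<open>i \<ge> 15\<close>; the remaining cases are evaluated.
\<close>

section \<open>Cycle weights\<close>

text \<open>The sum over all permutations of \<open>r\<close> points of \<open>a ^ p * N ^ q\<close>, where \<open>p\<close> counts the fixed
  points and \<open>q\<close> the longer cycles. Inserting a new point into an existing cycle leaves the
  weight unchanged, unless the cycle was a fixed point: then \<open>a\<close> becomes \<open>N\<close>.\<close>

fun cycle_weight :: "nat \<Rightarrow> nat \<Rightarrow> nat \<Rightarrow> nat" where
  "cycle_weight a N 0 = 1"
| "cycle_weight a N (Suc 0) = a"
| "cycle_weight a N (Suc (Suc r)) =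
     (Suc r + a) * cycle_weight a N (Suc r) + Suc r * (N - a) * cycle_weight a N r"

text \<open>Evaluating the two-step recurrence directly takes exponential time.\<close>

primrec cycle_weight_pair :: "nat \<Rightarrow> nat \<Rightarrow> nat \<Rightarrow> nat \<times> nat" where
  "cycle_weight_pair a N 0 = (1, 0)"
| "cycle_weight_pair a N (Suc r) =
     (let (x, y) = cycle_weight_pair a N r in ((r + a) * x + r * (N - a) * y, x))"

lemma cycle_weight_pair_Suc:
  "cycle_weight_pair a N (Suc r) = (cycle_weight a N (Suc r), cycle_weight a N r)"
  by (induction r) auto

lemma cycle_weight_code [code]: "cycle_weight a N r = fst (cycle_weight_pair a N r)"
  by (cases r) (use cycle_weight_pair_Suc in auto)

lemma cycle_weight_same: "cycle_weight N N r = pochhammer N r"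
  by (induction N N r rule: cycle_weight.induct) (auto simp: pochhammer_Suc)

text \<open>Absorbs the second term of the recurrence into the first in
  \<open>cycle_weight_Suc_le\<close>; \<open>a \<ge> 1\<close> supplies the unit by which
  \<open>Suc r\<close> exceeds \<open>Suc s\<close>.\<close>

lemma cycle_weight_ge: "a \<ge> 1 \<Longrightarrow> Suc r * cycle_weight a N r \<le> cycle_weight a N (Suc r)"
proof (cases r)
  case (Suc s)
  assume "a \<ge> 1"
  then have "Suc r * cycle_weight a N r \<le> (Suc s + a) * cycle_weight a N r"
    using Suc by (intro mult_right_mono) auto
  then show ?thesis using Suc by simp
qed simp

text \<open>The factor is the one by which \<open>pochhammer N\<close> grows, so an inequality
  against that symbol passes from r to r + 1.\<close>

lemma cycle_weight_Suc_le:
  assumes "1 \<le> a" "a \<le> N"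
  shows "cycle_weight a N (Suc r) \<le> (N + r) * cycle_weight a N r"
proof (cases r)
  case (Suc s)
  have "Suc s * cycle_weight a N s \<le> cycle_weight a N r"
    using cycle_weight_ge[OF assms(1), of s N] Suc by simp
  then have "(N - a) * (Suc s * cycle_weight a N s) \<le> (N - a) * cycle_weight a N r"
    by (rule mult_left_mono) simp
  then have "cycle_weight a N (Suc r) \<le> (r + a) * cycle_weight a N r + (N - a) * cycle_weight a N r"
    using Suc by (simp add: algebra_simps)
  also have "\<dots> = (N + r) * cycle_weight a N r"
    using assms(2) by (simp flip: distrib_right)
  finally show ?thesis .
qed (use assms in auto)



text \<open>Stated with lists so that \<open>code_simp\<close> can evaluate it: one Stirling row per
  n, and the Pochhammer symbol as an explicit product.\<close>

lemma stirling_cycle_weight_le_code: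
  "list_all (\<lambda>n. sum_list
      (map2 (\<lambda>s k. s * cycle_weight (2 ^ k) (2 ^ n) (Suc n)) (stirling_row n) [0..<Suc n])
     \<le> 2 * prod_list (map (\<lambda>j. 2 ^ n + j) [0..<Suc n])) [0..<15]"
  by code_simp

lemma stirling_cycle_weight_le_small:
  assumes "n < 15"
  shows "(\<Sum>k\<le>n. stirling n k * cycle_weight (2 ^ k) (2 ^ n) (Suc n))
      \<le> 2 * pochhammer (2 ^ n) (Suc n)"
proof -
  have "(\<Sum>k\<leftarrow>[0..<Suc n]. stirling n k * cycle_weight (2 ^ k) (2 ^ n) (Suc n))
     = sum_list
         (map2 (\<lambda>s k. s * cycle_weight (2 ^ k) (2 ^ n) (Suc n)) (stirling_row n) [0..<Suc n])"
    by (simp add: stirling_row_def zip_map1 zip_same_conv_map comp_def del: upt_Suc)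
  also have "\<dots> \<le> 2 * prod_list (map (\<lambda>j. 2 ^ n + j) [0..<Suc n])"
    using stirling_cycle_weight_le_code assms by (auto simp: list_all_iff simp del: upt_Suc)
  finally show ?thesis
    by (simp add: pochhammer_prod prod.distinct_set_conv_list[symmetric] interv_sum_list_conv_sum_set_nat
       atLeast0LessThan lessThan_Suc_atMost atLeast0AtMost del: upt_Suc)
qed

text \<open>The condition on \<open>e\<close> makes \<open>\<lambda> = a / N + e\<close> satisfy
  \<open>\<lambda>\<^sup>2 \<ge> (a / N + n / N) \<lambda> + n / N\<close>, the recurrence for the quotient up to \<open>r = n + 1\<close>.\<close>

lemma cycle_weight_le_power:
  fixes e :: real
  assumes N: "N > 0" and aN: "a \<le> N" and e: "e > 0"
    and en: "real n / real N \<le> (e - real n / real N) * e"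
    and r: "r \<le> Suc n"
  shows "real (cycle_weight a N r) \<le> (real a / real N + e) ^ r * pochhammer (real N) r"
  using r
proof (induction r rule: induct_nat_012)
  case 0
  then show ?case by simp
next
  case 1
  then show ?case using N e by (simp add: field_simps)
next
  case (ge2 r)
  define \<alpha> where "\<alpha> = real a / real N"
  define \<delta> where "\<delta> = real n / real N"
  define P where "P = pochhammer (real N) r"
  let ?P2 = "pochhammer (real N) (Suc (Suc r))"
  have P: "P \<ge> 0" unfolding P_def by (intro pochhammer_nonneg) (use N in simp)
  have P2: "?P2 = (real N + real r + 1) * ((real N + real r) * P)"
    by (simp add: pochhammer_Suc P_def algebra_simps)
  have \<alpha>: "\<alpha> \<ge> 0" "\<alpha> * real N = real a" and \<delta>: "\<delta> \<ge> 0" "\<delta> * real N = real n"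
    using N by (auto simp: \<alpha>_def \<delta>_def)
  have r: "real r + 1 \<le> real n" using ge2.prems by linarith
  \<comment> \<open>\<open>A\<close> and \<open>B\<close> bound the two coefficients of the
    recurrence by \<alpha> + \<delta> and \<delta>, each times the Pochhammer factors gained since
    the earlier term.\<close>
  have "real (Suc r + a) \<le> (\<alpha> + \<delta>) * real N" using \<alpha> \<delta> r by (simp add: distrib_right)
  also have "\<dots> \<le> (\<alpha> + \<delta>) * (real N + real r + 1)"
    using \<alpha> \<delta> by (intro mult_left_mono) auto
  finally have A: "real (Suc r + a) \<le> (\<alpha> + \<delta>) * (real N + real r + 1)" .
  have "real (Suc r) * real (N - a) \<le> real n * real N"
    using r by (intro mult_mono) auto
  also have "\<dots> = \<delta> * (real N * real N)" using \<delta>(2) by (metis mult.assoc)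
  also have "\<dots> \<le> \<delta> * ((real N + real r + 1) * (real N + real r))"
    using \<delta> by (intro mult_left_mono mult_mono) auto
  finally have B: "real (Suc r) * real (N - a) \<le> \<delta> * ((real N + real r + 1) * (real N + real r))" .
  have "real (cycle_weight a N (Suc (Suc r))) =
      real (Suc r + a) * real (cycle_weight a N (Suc r)) + real (Suc r) * real (N - a)
          * real (cycle_weight a N r)"
    by (simp only: cycle_weight.simps of_nat_add of_nat_mult)
  also have "\<dots> \<le> ((\<alpha> + \<delta>) * (real N + real r + 1)) * ((\<alpha> + e) ^ Suc r * ((real N + real r) * P))
      + (\<delta> * ((real N + real r + 1) * (real N + real r))) * ((\<alpha> + e) ^ r * P)"
  proof (intro add_mono mult_mono[OF A] mult_mono[OF B])
    show "real (cycle_weight a N (Suc r)) \<le> (\<alpha> + e) ^ Suc r * ((real N + real r) * P)"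
      using ge2 by (simp add: P_def \<alpha>_def pochhammer_Suc mult_ac)
    show "real (cycle_weight a N r) \<le> (\<alpha> + e) ^ r * P"
      using ge2 by (simp add: P_def \<alpha>_def)
  qed (use \<alpha> \<delta> in auto)
  also have "\<dots> = ((\<alpha> + \<delta>) * (\<alpha> + e) + \<delta>) * ((\<alpha> + e) ^ r * ?P2)"
    unfolding P2 by (simp add: algebra_simps)
  also have "\<dots> \<le> (\<alpha> + e) ^ 2 * ((\<alpha> + e) ^ r * ?P2)"
  proof (rule mult_right_mono)
    \<comment> \<open>Otherwise the right side of \<open>en\<close> would be negative. Hence
      \<open>en\<close> survives replacing its last factor e by \<alpha> + e, and adding (\<alpha> +
      \<delta>) (\<alpha> + e) to both sides gives the square.\<close>
    have "e - \<delta> \<ge> 0"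
      using en e \<delta> by (fold \<delta>_def) (metis less_eq_real_def mult_neg_pos not_le order_trans)
    then have "\<delta> \<le> (e - \<delta>) * (\<alpha> + e)"
      using en \<alpha> unfolding \<delta>_def[symmetric] by (simp add: distrib_left add_increasing)
    then show "(\<alpha> + \<delta>) * (\<alpha> + e) + \<delta> \<le> (\<alpha> + e)\<^sup>2"
      by (simp add: power2_eq_square algebra_simps)
    show "0 \<le> (\<alpha> + e) ^ r * ?P2" using P2 P \<alpha> e by auto
  qed
  also have "\<dots> = (\<alpha> + e) ^ Suc (Suc r) * ?P2" by (simp add: power2_eq_square mult_ac)
  finally show ?case unfolding \<alpha>_def .
qed

section \<open>Estimates at r = n + 1 for n >= 15\<close>

lemma two_power_ge: "n \<ge> 15 \<Longrightarrow> 7 * n ^ 3 \<le> (2::nat) ^ n"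
proof (induction n rule: nat_induct_at_least)
  case (Suc n)
  have "15 * n \<le> n ^ 2" "15 * n ^ 2 \<le> n ^ 3"
    using Suc by (auto simp: power2_eq_square power3_eq_cube)
  moreover have "Suc n ^ 3 = n ^ 3 + 3 * n ^ 2 + 3 * n + 1"
    by (simp add: power2_eq_square power3_eq_cube algebra_simps)
  ultimately have "Suc n ^ 3 \<le> 2 * n ^ 3" using Suc(1) by linarith
  then have "7 * Suc n ^ 3 \<le> 2 * (7 * n ^ 3)" by simp
  also have "\<dots> \<le> 2 * 2 ^ n" using Suc by (intro mult_left_mono) auto
  finally show ?case by simp
qed simp

text \<open>By Bernoulli (1 + 1/n)^n >= 2, so the step to n + 1 multiplies the right side by at
  least 2 (n + 1), the growth of the left side. The inequality fails at n = 5.\<close>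

lemma two_power_mult_fact_le: "n \<ge> 6 \<Longrightarrow> 2 ^ n * fact n \<le> (n ^ n :: nat)"
proof (induction n rule: nat_induct_at_least)
  case (Suc n)
  have "2 \<le> (1 + 1 / real n) ^ n"
    using Bernoulli_inequality[of "1 / real n" n] Suc order_trans[of "- 1" 0 "1 / real n"] by simp
  then have "2 * real n ^ n \<le> (1 + 1 / real n) ^ n * real n ^ n"
    by (rule mult_right_mono) simp
  also have "\<dots> = (real n + 1) ^ n"
    using Suc by (simp add: field_simps flip: power_mult_distrib)
  finally have "real (2 * n ^ n) \<le> real (Suc n ^ n)" by (simp add: add_ac)
  then have *: "2 * n ^ n \<le> Suc n ^ n" using of_nat_le_iff by blast
  have "2 ^ Suc n * fact (Suc n) = Suc n * (2 * (2 ^ n * fact n :: nat))"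
      by (simp add: algebra_simps)
  also have "\<dots> \<le> Suc n * (2 * n ^ n)" using Suc by (intro mult_left_mono) auto
  also have "\<dots> \<le> Suc n * Suc n ^ n" using * by (intro mult_left_mono) auto
  finally show ?case by simp
qed (simp add: fact_numeral)

text \<open>The ratio 5/8 is 5/4, from the case split in
  \<open>stirling_cycle_weight_le_large\<close>, times 1/2, from
  \<open>sum_stirling_power_less\<close>.\<close>

lemma geometric_decay: "n \<ge> 15 \<Longrightarrow> real n ^ 2 * (5 / 8) ^ Suc n \<le> 1 / 2"
proof (induction n rule: nat_induct_at_least)
  case (Suc n)
  have "15 * real n \<le> real n ^ 2"
    using Suc by (auto simp: power2_eq_square)
  moreover have "(real n + 1) ^ 2 = real n ^ 2 + 2 * real n + 1"
    by (simp add: power2_eq_square algebra_simps)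
  ultimately have "(real n + 1) ^ 2 * (5 / 8) \<le> real n ^ 2"
    using Suc by linarith
  then have "(real n + 1) ^ 2 * (5 / 8) * (5 / 8) ^ Suc n \<le> real n ^ 2 * (5 / 8) ^ Suc n"
    by (rule mult_right_mono) simp
  also have "\<dots> \<le> 1 / 2" by (rule Suc)
  finally show ?case by (simp add: mult_ac add_ac)
qed (simp add: eval_nat_numeral)

text \<open>Apply 1 + t <= exp t to each factor 1 + j/x; the exponents add up to at most n^2 /
  (2x).\<close>

lemma pochhammer_le_exp:
  fixes x :: real assumes "x > 0"
  shows "pochhammer x n \<le> x ^ n * exp (real (n * n) / (2 * x))"
proof -
  have "pochhammer x n = (\<Prod>j<n. x + real j)" by (simp add: pochhammer_prod atLeast0LessThan)
  also have "\<dots> \<le> (\<Prod>j<n. x * exp (real j / x))"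
  proof (rule prod_mono)
    fix j
    have "x + real j = x * (1 + real j / x)" using assms by (simp add: field_simps)
    also have "\<dots> \<le> x * exp (real j / x)"
      using assms exp_ge_add_one_self by (intro mult_left_mono) auto
    finally show "0 \<le> x + real j \<and> x + real j \<le> x * exp (real j / x)" using assms by simp
  qed
  also have "\<dots> = x ^ n * exp ((\<Sum>j<n. real j) / x)"
    by (simp add: prod.distrib exp_sum sum_divide_distrib)
  also have "\<dots> \<le> x ^ n * exp (real (n * n) / (2 * x))"
  proof -
    have "(\<Sum>j<n. real j) \<le> real (n * n) / 2" by (induction n) (auto simp: algebra_simps)
    then show ?thesis using assms by (auto intro!: mult_left_mono simp: field_simps)
  qed
  finally show ?thesis .
qed

text \<open>With x = 2^(n+1) the power is x^k / x^n, so the Stirling generating function turns the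
  sum, once k = n is included, into \<open>pochhammer x n / x ^ n\<close>. This is at most exp s for
  s = n^2 / (2x); the hypothesis says s <= 1, whence exp s - 1 <= 2s.\<close>

lemma sum_stirling_power_less:
  assumes "n ^ 2 \<le> 2 ^ (n + 2)"
  shows "(\<Sum>k<n. real (stirling n k) * (2 ^ k / 2 ^ n) ^ Suc n) \<le> real n ^ 2 / 2 ^ Suc n"
proof -
  define x :: real where "x = 2 ^ Suc n"
  have x: "x > 0" by (simp add: x_def)
  define s where "s = real (n * n) / (2 * x)"
  have s: "0 \<le> s" "s \<le> 1"
  proof -
    have "real (n ^ 2) \<le> real (2 ^ (n + 2))" using assms of_nat_le_iff by blast
    then show "s \<le> 1" by (simp add: s_def x_def power2_eq_square field_simps)
  qed (simp add: s_def x_def)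
  have "((2::real) ^ k / 2 ^ n) ^ Suc n = x ^ k / x ^ n" for k
    by (simp add: x_def power_divide mult.commute flip: power_mult power_Suc)
  then have "(\<Sum>k<n. real (stirling n k) * (2 ^ k / 2 ^ n) ^ Suc n)
      = (\<Sum>k<n. real (stirling n k) * x ^ k) / x ^ n"
    by (simp add: sum_divide_distrib del: power_Suc)
  also have "(\<Sum>k<n. real (stirling n k) * x ^ k) = pochhammer x n - x ^ n"
    by (simp add: stirling_pochhammer[symmetric] lessThan_Suc_atMost[symmetric])
  also have "(pochhammer x n - x ^ n) / x ^ n \<le> exp s - 1"
    using pochhammer_le_exp[OF x, of n] x by (simp add: field_simps s_def)
  also have "\<dots> \<le> s + s\<^sup>2" using exp_bound[OF s] by simp
  also have "\<dots> \<le> 2 * s" using s by (simp add: power2_eq_square mult_left_le)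
  also have "\<dots> = real n ^ 2 / 2 ^ Suc n" by (simp add: s_def x_def power2_eq_square)
  finally show ?thesis .
qed

text \<open>The summand k = n is the Pochhammer symbol itself; the others add up to at most one more
  copy, in two halves.\<close>

lemma stirling_cycle_weight_le_large:
  assumes n: "n \<ge> 15"
  shows "(\<Sum>k\<le>n. stirling n k * cycle_weight (2 ^ k) (2 ^ n) (Suc n))
      \<le> 2 * pochhammer (2 ^ n) (Suc n)"
proof -
  \<comment> \<open>Chosen so that 5e = 2/n: then (5e)^(n+1) n! equals (2/n) 2^n n! / n^n.\<close>
  define e where "e = 2 / (5 * real n)"
  define P where "P = pochhammer (2 ^ n :: real) (Suc n)"
  have P: "P \<ge> 0" unfolding P_def by (intro pochhammer_nonneg) simp
  have e: "e > 0" using n by (simp add: e_def)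
  have pow: "7 * real n ^ 3 \<le> 2 ^ n"
  proof -
    have "real (7 * n ^ 3) \<le> real (2 ^ n)" using two_power_ge[OF n] of_nat_le_iff by blast
    then show ?thesis by simp
  qed
  \<comment> \<open>This is d (1 + e) <= e^2 rearranged. The factor 7 in \<open>two_power_ge\<close>
    gives d <= 1 / (7 n^2) = (25/28) e^2, and (25/28) (1 + 2/75) = 11/12. With that factor
    \<open>two_power_ge\<close> fails at n = 14, whence the threshold 15.\<close>
  have en: "real n / real (2 ^ n) \<le> (e - real n / real (2 ^ n)) * e"
  proof -
    define d where "d = real n / 2 ^ n"
    have "d \<le> real n / (7 * real n ^ 3)" unfolding d_def using pow n
      by (intro divide_left_mono) auto
    also have "\<dots> = 25 / 28 * e\<^sup>2" using n
        by (simp add: e_def power2_eq_square power3_eq_cube field_simps)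
    finally have d: "d \<le> 25 / 28 * e\<^sup>2" .
    have "e \<le> 2 / 75" using n by (simp add: e_def field_simps)
    then have "d * (1 + e) \<le> 25 / 28 * e\<^sup>2 * (1 + 2 / 75)"
      using d e by (intro mult_mono) (auto simp: d_def)
    also have "\<dots> \<le> e\<^sup>2" by (simp add: field_simps)
    finally show ?thesis by (simp add: d_def power2_eq_square algebra_simps add_divide_distrib)
  qed
  have term_le: "real (cycle_weight (2 ^ k) (2 ^ n) (Suc n)) \<le>
      ((5 / 4) ^ Suc n * (2 ^ k / 2 ^ n) ^ Suc n + (5 * e) ^ Suc n) * P" if "k < n" for k
  proof -
    define \<alpha> :: real where "\<alpha> = 2 ^ k / 2 ^ n"
    have \<alpha>: "\<alpha> \<ge> 0" by (simp add: \<alpha>_def)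
    have "real (cycle_weight (2 ^ k) (2 ^ n) (Suc n)) \<le> (\<alpha> + e) ^ Suc n * P"
      using cycle_weight_le_power[of "2 ^ n" "2 ^ k" e n "Suc n"] e en that
      by (simp add: \<alpha>_def P_def)
    \<comment> \<open>Either e <= \<alpha>/4 and the base is at most (5/4) \<alpha>, or \<alpha> <
      4e and it is below 5e; the sum of both powers covers either case.\<close>
    also have "(\<alpha> + e) ^ Suc n \<le> (5 / 4) ^ Suc n * \<alpha> ^ Suc n + (5 * e) ^ Suc n"
    proof (cases "e \<le> \<alpha> / 4")
      case True
      then have "(\<alpha> + e) ^ Suc n \<le> (5 / 4 * \<alpha>) ^ Suc n" using \<alpha> e by (intro power_mono) auto
      also have "\<dots> = (5 / 4) ^ Suc n * \<alpha> ^ Suc n" by (rule power_mult_distrib)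
      finally show ?thesis using e by (simp add: add_increasing2 del: power_Suc)
    next
      case False
      then have "(\<alpha> + e) ^ Suc n \<le> (5 * e) ^ Suc n" using \<alpha> e by (intro power_mono) auto
      then show ?thesis using \<alpha> by (simp add: add_increasing del: power_Suc)
    qed
    finally show ?thesis using P by (simp add: \<alpha>_def mult_right_mono)
  qed
  have "(\<Sum>k<n. real (stirling n k) * ((5 / 4) ^ Suc n * (2 ^ k / 2 ^ n) ^ Suc n + (5 * e) ^ Suc n))
      = (5 / 4) ^ Suc n * (\<Sum>k<n. real (stirling n k) * (2 ^ k / 2 ^ n) ^ Suc n)
        + (5 * e) ^ Suc n * real (\<Sum>k<n. stirling n k)"
    by (simp add: sum.distrib sum_distrib_left sum_distrib_right distrib_left mult_ac del: power_Suc)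
  also have "\<dots> \<le> 1 / 2 + 1 / 2"
  proof (rule add_mono)
    have "n ^ 2 \<le> 2 ^ (n + 2)"
    proof -
      have "n ^ 2 \<le> 7 * n ^ 3" using n by (simp add: power3_eq_cube power2_eq_square)
      also have "\<dots> \<le> 2 ^ (n + 2)" using two_power_ge[OF n] by simp
      finally show ?thesis .
    qed
    then have "(5 / 4) ^ Suc n * (\<Sum>k<n. real (stirling n k) * (2 ^ k / 2 ^ n) ^ Suc n)
        \<le> (5 / 4) ^ Suc n * (real n ^ 2 / 2 ^ Suc n)"
      by (intro mult_left_mono sum_stirling_power_less) auto
    also have "\<dots> = real n ^ 2 * (5 / 4 / 2) ^ Suc n"
      by (simp only: power_divide) simp
    also have "\<dots> \<le> 1 / 2" using geometric_decay[OF n] by simp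
    finally show "(5 / 4) ^ Suc n * (\<Sum>k<n. real (stirling n k) * (2 ^ k / 2 ^ n) ^ Suc n) \<le> 1 / 2" .
    have "(\<Sum>k<n. stirling n k) \<le> fact n"
      unfolding sum_stirling[symmetric] by (rule sum_mono2) auto
    then have "(5 * e) ^ Suc n * real (\<Sum>k<n. stirling n k) \<le> (5 * e) ^ Suc n * real (fact n)"
      using e by (intro mult_left_mono) (auto simp del: of_nat_sum of_nat_fact)
    also have "\<dots> = 2 / real n * (real (2 ^ n * fact n) / real (n ^ n))"
      by (simp add: e_def power_divide)
    also have "\<dots> \<le> 2 / real n * 1"
      using two_power_mult_fact_le[of n] n
      by (intro mult_left_mono) (auto simp: divide_le_eq_1 simp del: of_nat_mult of_nat_power)
    also have "\<dots> \<le> 1 / 2" using n by simp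
    finally show "(5 * e) ^ Suc n * real (\<Sum>k<n. stirling n k) \<le> 1 / 2" .
  qed
  finally have sum_le:
      "(\<Sum>k<n. real (stirling n k)
      * ((5 / 4) ^ Suc n * (2 ^ k / 2 ^ n) ^ Suc n + (5 * e) ^ Suc n)) \<le> 1"
    by simp
  have poch: "real (pochhammer (2 ^ n) (Suc n)) = P"
    unfolding P_def using pochhammer_of_nat[of "2 ^ n" "Suc n", where ?'a = real] by simp
  have "(\<Sum>k<n. real (stirling n k) * real (cycle_weight (2 ^ k) (2 ^ n) (Suc n))) \<le>
     (\<Sum>k<n. real (stirling n k) * ((5 / 4) ^ Suc n * (2 ^ k / 2 ^ n) ^ Suc n
         + (5 * e) ^ Suc n)) * P"
    unfolding sum_distrib_right mult.assoc
    by (intro sum_mono mult_left_mono) (use term_le in auto)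
  also have "\<dots> \<le> P" using mult_right_mono[OF sum_le P] by simp
  finally have "real (\<Sum>k\<le>n. stirling n k * cycle_weight (2 ^ k) (2 ^ n) (Suc n))
      \<le> real (2 * pochhammer (2 ^ n) (Suc n))"
    using poch by (simp add: cycle_weight_same lessThan_Suc_atMost[symmetric])
  then show ?thesis using of_nat_le_iff by blast
qed

section \<open>Colourings constant on cycles\<close>

text \<open>For \<open>D \<subseteq> A\<close> their number is the weight that
  \<open>cycle_weight\<close> sums, with a = \<open>card D\<close> and N = \<open>card A\<close>. In
  the upper bound \<open>A\<close> is \<open>Pow S\<close> and \<open>D\<close> the
  \<sigma>-invariant subsets.\<close>

definition cycle_colourings :: "'a set \<Rightarrow> 'a set \<Rightarrow> 'b set \<Rightarrow> ('b \<Rightarrow> 'b) \<Rightarrow> ('b \<Rightarrow> 'a) set" where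
  "cycle_colourings D A J \<tau> =
     {f \<in> J \<rightarrow>\<^sub>E A. \<forall>y\<in>J. f (\<tau> y) = f y \<and> (\<tau> y = y \<longrightarrow> f y \<in> D)}"

text \<open>This lemma and the next two treat the ways a new point z can join a permutation: it
  stays fixed, with its own colour from \<open>D\<close>; it forms a two-cycle with a fixed point j,
  with one colour from \<open>A\<close>; or it enters a longer cycle and inherits the
  colour.\<close>

lemma card_cycle_colourings_fixed:
  assumes z: "z \<notin> J" and q: "q permutes J" and DA: "D \<subseteq> A"
  shows "card (cycle_colourings D A (insert z J) q) = card D * card (cycle_colourings D A J q)"
proof -
  have qz: "q z = z" using permutes_not_in[OF q z] .
  have qJ: "q y \<in> J" if "y \<in> J" for y using permutes_in_image[OF q] that by simp
  have "bij_betw (\<lambda>(v, f). f(z := v)) (D \<times> cycle_colourings D A J q) (cycle_colourings D A (insert z J) q)"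
  proof (rule bij_betwI[where g = "\<lambda>f. (f z, restrict f J)"])
    show "(\<lambda>(v, f). f(z := v)) \<in> D \<times> cycle_colourings D A J q \<rightarrow> cycle_colourings D A (insert z J) q"
      using z qz qJ DA by (fastforce simp: cycle_colourings_def PiE_iff extensional_def)
    show "(\<lambda>f. (f z, restrict f J)) \<in> cycle_colourings D A (insert z J) q
        \<rightarrow> D \<times> cycle_colourings D A J q"
      using z qz qJ by (fastforce simp: cycle_colourings_def PiE_iff)
  next
    fix p assume "p \<in> D \<times> cycle_colourings D A J q"
    then show "(((\<lambda>(v, f). f(z := v)) p) z, restrict ((\<lambda>(v, f). f(z := v)) p) J) = p"
      using z by (auto simp: cycle_colourings_def PiE_iff extensional_def restrict_def fun_eq_iff)
  next
    fix f assume "f \<in> cycle_colourings D A (insert z J) q"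
    then show "(\<lambda>(v, f). f(z := v)) (f z, restrict f J) = f"
      using z by (auto simp: cycle_colourings_def PiE_iff extensional_def restrict_def fun_eq_iff)
  qed
  then show ?thesis by (simp add: bij_betw_same_card[symmetric] card_cartesian_product)
qed

lemma card_cycle_colourings_extend_fixed:
  assumes z: "z \<notin> insert j J" and j: "j \<notin> J" and q: "q permutes J"
  shows "card (cycle_colourings D A (insert z (insert j J)) (transpose z j \<circ> q))
    = card A * card (cycle_colourings D A J q)"
proof -
  have qz: "q z = z" "q j = j" using permutes_not_in[OF q] z j by auto
  have qJ: "q y \<in> J" if "y \<in> J" for y using permutes_in_image[OF q] that by simp
  have t: "(transpose z j \<circ> q) z = j" "(transpose z j \<circ> q) j = z"
      "\<And>y. y \<in> J \<Longrightarrow> (transpose z j \<circ> q) y = q y"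
    using qz qJ z j by (auto simp: transpose_def)
  have mem: "f \<in> cycle_colourings D A (insert z (insert j J)) (transpose z j \<circ> q) \<longleftrightarrow>
      f \<in> insert z (insert j J) \<rightarrow>\<^sub>E A \<and> f z = f j \<and> (\<forall>y\<in>J. f (q y) = f y \<and> (q y = y
          \<longrightarrow> f y \<in> D))" for f
    using t z by (auto simp: cycle_colourings_def simp del: o_apply)
  have "bij_betw (\<lambda>(v, f). f(z := v, j := v)) (A \<times> cycle_colourings D A J q)
      (cycle_colourings D A (insert z (insert j J)) (transpose z j \<circ> q))"
  proof (rule bij_betwI[where g = "\<lambda>f. (f z, restrict f J)"])
    show "(\<lambda>(v, f). f(z := v, j := v)) \<in> A \<times> cycle_colourings D A J q \<rightarrow>
        cycle_colourings D A (insert z (insert j J)) (transpose z j \<circ> q)"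
    proof clarify
      fix v f assume v: "v \<in> A" and f: "f \<in> cycle_colourings D A J q"
      let ?g = "f(z := v, j := v)"
      have "?g \<in> insert z (insert j J) \<rightarrow>\<^sub>E A"
        using v f by (auto simp: cycle_colourings_def PiE_iff extensional_def)
      moreover have "?g (q y) = ?g y \<and> (q y = y \<longrightarrow> ?g y \<in> D)" if y: "y \<in> J" for y
      proof -
        have "?g y = f y" "?g (q y) = f (q y)" using z j y qJ[OF y] by auto
        then show ?thesis using f y by (auto simp: cycle_colourings_def)
      qed
      ultimately show "?g \<in> cycle_colourings D A (insert z (insert j J)) (transpose z j \<circ> q)"
        using z unfolding mem by auto
    qed
    show "(\<lambda>f. (f z, restrict f J)) \<in> cycle_colourings D A (insert z (insert j J)) (transpose z j \<circ> q) \<rightarrow>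
        A \<times> cycle_colourings D A J q"
      using qJ by (auto simp: mem) (auto simp: cycle_colourings_def PiE_iff)
  next
    fix p assume "p \<in> A \<times> cycle_colourings D A J q"
    then show "(((\<lambda>(v, f). f(z := v, j := v)) p) z, restrict ((\<lambda>(v, f). f(z := v, j := v)) p) J) = p"
      using z j by (auto simp: cycle_colourings_def PiE_iff extensional_def restrict_def fun_eq_iff)
  next
    fix f assume "f \<in> cycle_colourings D A (insert z (insert j J)) (transpose z j \<circ> q)"
    then show "(\<lambda>(v, f). f(z := v, j := v)) (f z, restrict f J) = f"
      using z j by (auto simp: mem PiE_iff extensional_def restrict_def fun_eq_iff)
  qed
  then show ?thesis by (simp add: bij_betw_same_card[symmetric] card_cartesian_product)
qed

lemma card_cycle_colourings_extend_moved:
  assumes z: "z \<notin> J" and j: "j \<in> J" and q: "q permutes J" and qj: "q j \<noteq> j"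
  shows "card (cycle_colourings D A (insert z J) (transpose z j \<circ> q))
      = card (cycle_colourings D A J q)"
proof -
  have qz: "q z = z" using permutes_not_in[OF q z] .
  have qJ: "q y \<in> J" if "y \<in> J" for y using permutes_in_image[OF q] that by simp
  obtain i where i: "q i = j" "i \<in> J" using q j by (metis permutes_def permutes_in_image)
  have inj: "q y = j \<longleftrightarrow> y = i" for y using i permutes_inj[OF q] by (metis injD)
  have t: "(transpose z j \<circ> q) z = j" "(transpose z j \<circ> q) i = z"
      "\<And>y. y \<in> J \<Longrightarrow> y \<noteq> i \<Longrightarrow> (transpose z j \<circ> q) y = q y"
    using qz qJ z j i inj by (auto simp: transpose_def)
  \<comment> \<open>The new permutation runs from i through z to j where q goes from i to j
    directly. As q moves j, the points i and j differ, so no fixed-point condition changes.\<close>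
  have mem: "f \<in> cycle_colourings D A (insert z J) (transpose z j \<circ> q) \<longleftrightarrow>
      f \<in> insert z J \<rightarrow>\<^sub>E A \<and> f z = f j \<and> (\<forall>y\<in>J. f (q y) = f y \<and> (q y = y \<longrightarrow> f y \<in> D))"
    (is "?L \<longleftrightarrow> ?R") for f
  proof
    assume f: ?L
    have c: "f ((transpose z j \<circ> q) y) = f y" "(transpose z j \<circ> q) y = y \<Longrightarrow> f y \<in> D"
      if "y \<in> insert z J" for y
      using f that unfolding cycle_colourings_def by blast+
    have fz: "f j = f z" using c(1)[of z] unfolding t(1) by blast
    have fi: "f z = f i" using c(1)[of i] i(2) unfolding t(2) by blast
    have "f (q y) = f y \<and> (q y = y \<longrightarrow> f y \<in> D)" if y: "y \<in> J" for y
    proof (cases "y = i")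
      case True
      have "i \<noteq> j" using i(1) qj by blast
      then show ?thesis unfolding True i(1) using fz fi by simp
    next
      case False
      then show ?thesis using c[of y] t(3)[OF y False] y by simp
    qed
    then show ?R using f fz[symmetric] unfolding cycle_colourings_def by blast
  next
    assume f: ?R
    have "f ((transpose z j \<circ> q) y) = f y \<and> ((transpose z j \<circ> q) y = y \<longrightarrow> f y \<in> D)"
      if y: "y \<in> insert z J" for y
    proof -
      consider "y = z" | "y = i" | "y \<in> J" "y \<noteq> i" using y by auto
      then show ?thesis
      proof cases
        case 1
        have "f z = f j" "j \<noteq> z" using f z j by blast+
        then show ?thesis unfolding 1 t(1) by simp
      next
        case 2
        have "f z = f i" "z \<noteq> i" using f z i by metis+
        then show ?thesis unfolding 2 t(2) by simp
      next
        case 3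
        then show ?thesis unfolding t(3)[OF 3] using f by blast
      qed
    qed
    then show ?L using f unfolding cycle_colourings_def by blast
  qed
  have "bij_betw (\<lambda>f. f(z := f j)) (cycle_colourings D A J q) (cycle_colourings D A (insert z J) (transpose z j \<circ> q))"
  proof (rule bij_betwI[where g = "\<lambda>f. restrict f J"])
    show "(\<lambda>f. f(z := f j)) \<in> cycle_colourings D A J q
        \<rightarrow> cycle_colourings D A (insert z J) (transpose z j \<circ> q)"
    proof
      fix f assume f: "f \<in> cycle_colourings D A J q"
      have "f(z := f j) \<in> insert z J \<rightarrow>\<^sub>E A"
        using f j by (auto simp: cycle_colourings_def PiE_iff extensional_def)
      moreover have "(f(z := f j)) y = f y" "(f(z := f j)) (q y) = f (q y)" if "y \<in> J" for y
        using z that qJ[OF that] by auto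
      ultimately show "f(z := f j) \<in> cycle_colourings D A (insert z J) (transpose z j \<circ> q)"
        using f z j unfolding mem by (auto simp: cycle_colourings_def simp del: fun_upd_apply) simp
    qed
    show "(\<lambda>f. restrict f J) \<in> cycle_colourings D A (insert z J) (transpose z j \<circ> q)
        \<rightarrow> cycle_colourings D A J q"
      using qJ by (auto simp: mem) (auto simp: cycle_colourings_def PiE_iff)
  next
    fix f assume "f \<in> cycle_colourings D A J q"
    then show "restrict (f(z := f j)) J = f"
      using z by (auto simp: cycle_colourings_def PiE_iff extensional_def restrict_def fun_eq_iff)
  next
    fix f assume "f \<in> cycle_colourings D A (insert z J) (transpose z j \<circ> q)"
    then show "(restrict f J)(z := restrict f J j) = f"
      using z j by (auto simp: mem PiE_iff extensional_def restrict_def fun_eq_iff)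
  qed
  then show ?thesis by (rule bij_betw_same_card[symmetric])
qed

lemma permutes_fixing_iff: "q permutes J - {j} \<longleftrightarrow> q permutes J \<and> q j = j"
proof
  assume "q permutes J - {j}"
  then show "q permutes J \<and> q j = j"
    using permutes_subset[of q "J - {j}" J] permutes_not_in[of q "J - {j}" j] by auto
next
  assume "q permutes J \<and> q j = j"
  then show "q permutes J - {j}" by (auto intro: permutes_superset[of q J])
qed

text \<open>Strong induction, as the recurrence goes back two sizes. The permutations of
  \<open>insert z J'\<close> are sorted by the image of z.\<close>

lemma sum_card_cycle_colourings:
  fixes J :: "'b set" and A D :: "'a set"
  assumes "finite J" "finite A" "D \<subseteq> A"
  shows "(\<Sum>\<tau> | \<tau> permutes J. card (cycle_colourings D A J \<tau>))
      = cycle_weight (card D) (card A) (card J)"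
  using assms(1)
proof (induction "card J" arbitrary: J rule: less_induct)
  case less
  define W where "W J' = (\<Sum>\<tau> | \<tau> permutes J'. card (cycle_colourings D A J' \<tau>))" for J' :: "'b set"
  show ?case
  proof (cases "J = {}")
    case True
    then show ?thesis by (simp add: cycle_colourings_def)
  next
    case False
    then obtain z J' where J: "J = insert z J'" "z \<notin> J'" by (metis Set.set_insert ex_in_conv)
    have fin: "finite J'" using less.prems J by simp
    have cardJ: "card J = Suc (card J')" using fin J by simp
    have IH: "W K = cycle_weight (card D) (card A) (card K)" if "K \<subseteq> J'" for K
    proof -
      have "finite K" "card K \<le> card J'" using that fin by (auto intro: finite_subset card_mono)
      then show ?thesis unfolding W_def using less.hyps cardJ by simp
    qed
    have fixz: "(\<Sum>q | q permutes J'. card (cycle_colourings D A J (transpose z z \<circ> q)))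
        = card D * W J'"
      using J assms(3) by (simp add: card_cycle_colourings_fixed W_def sum_distrib_left)
    \<comment> \<open>If q fixes j, inserting z turns \<open>card D\<close> choices for j into
      \<open>card A\<close>. The excess is summed over the q fixing j, that is, over the
      permutations of \<open>J' - {j}\<close>.\<close>
    have movez: "(\<Sum>q | q permutes J'. card (cycle_colourings D A J (transpose z j \<circ> q))) =
        W J' + (card A - card D) * W (J' - {j})" if j: "j \<in> J'" for j
    proof -
      let ?P = "{q. q permutes J'}" and ?F = "{q. q permutes J' - {j}}"
      have F: "?F \<subseteq> ?P" "\<And>q. q \<in> ?P - ?F \<Longrightarrow> q j \<noteq> j" by (auto simp: permutes_fixing_iff)
      have finP: "finite ?P" using fin by (rule finite_permutations)
      have DA: "card D \<le> card A" using assms by (simp add: card_mono)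
      have c1: "card (cycle_colourings D A J (transpose z j \<circ> q)) =
           card (cycle_colourings D A J' q) + (card A - card D)
               * card (cycle_colourings D A (J' - {j}) q)" if "q \<in> ?F" for q
      proof -
        have q: "q permutes J' - {j}" using that by simp
        have "card (cycle_colourings D A J (transpose z j \<circ> q))
            = card A * card (cycle_colourings D A (J' - {j}) q)"
          using card_cycle_colourings_extend_fixed[of z j "J' - {j}" q D A] q J j
          by (auto simp: insert_absorb)
        moreover have
            "card (cycle_colourings D A J' q) = card D * card (cycle_colourings D A (J' - {j}) q)"
          using card_cycle_colourings_fixed[of j "J' - {j}" q D A] q j assms(3)
          by (simp add: insert_absorb)
        ultimately show ?thesis using DA by (simp flip: distrib_right)
      qed
      have "(\<Sum>q\<in>?P. card (cycle_colourings D A J (transpose z j \<circ> q))) =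
          (\<Sum>q\<in>?P - ?F. card (cycle_colourings D A J (transpose z j \<circ> q)))
              + (\<Sum>q\<in>?F. card (cycle_colourings D A J (transpose z j \<circ> q)))"
        by (rule sum.subset_diff[OF F(1) finP])
      also have "(\<Sum>q\<in>?P - ?F. card (cycle_colourings D A J (transpose z j \<circ> q)))
          = (\<Sum>q\<in>?P - ?F. card (cycle_colourings D A J' q))"
        unfolding J(1)
            by (intro sum.cong refl card_cycle_colourings_extend_moved) (use J j F(2) in auto)
      also have "(\<Sum>q\<in>?F. card (cycle_colourings D A J (transpose z j \<circ> q))) =
          (\<Sum>q\<in>?F. card (cycle_colourings D A J' q)) + (card A - card D) * W (J' - {j})"
        unfolding W_def sum_distrib_left sum.distrib[symmetric] by (intro sum.cong) (use c1 in auto)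
      finally show ?thesis
          using sum.subset_diff[OF F(1) finP, of "\<lambda>q. card (cycle_colourings D A J' q)"]
        by (simp only: W_def add.assoc)
    qed
    have "W J = (\<Sum>b\<in>insert z J'. \<Sum>q | q permutes J'. card (cycle_colourings D A J (transpose z b \<circ> q)))"
      unfolding W_def J(1) using sum_over_permutations_insert[OF fin J(2)] .
    also have "\<dots> = card D * W J' + (\<Sum>j\<in>J'. W J' + (card A - card D) * W (J' - {j}))"
      using fin J(2) fixz movez by (simp del: id_o)
    also have "\<dots> = cycle_weight (card D) (card A) (card J)"
    proof (cases "card J'")
      case 0
      then show ?thesis using fin IH[of J'] by (simp add: cardJ)
    next
      case (Suc r)
      have "W (J' - {j}) = cycle_weight (card D) (card A) r" if "j \<in> J'" for j
        using IH[of "J' - {j}"] that fin Suc by simp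
      then show ?thesis using IH[of J'] by (simp add: cardJ Suc algebra_simps)
    qed
    finally show ?thesis by (simp add: W_def)
  qed
qed

section \<open>Subsets invariant under a permutation\<close>

text \<open>For \<sigma> permuting S these are the unions of cycles, so c cycles give 2^c sets;
  counting them replaces counting cycles.\<close>

definition invariant_subsets :: "'a set \<Rightarrow> ('a \<Rightarrow> 'a) \<Rightarrow> 'a set set" where
  "invariant_subsets S \<sigma> = {X \<in> Pow S. \<forall>x. \<sigma> x \<in> X \<longleftrightarrow> x \<in> X}"

lemma card_invariant_subsets_fixed:
  assumes fin: "finite S" and x: "x \<notin> S" and q: "q permutes S"
  shows "card (invariant_subsets (insert x S) q) = 2 * card (invariant_subsets S q)"
proof -
  have qx: "q y = x \<longleftrightarrow> y = x" for y
    using permutes_not_in[OF q x] permutes_inj[OF q] by (metis injD)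
  have eq: "invariant_subsets (insert x S) q
      = invariant_subsets S q \<union> insert x ` invariant_subsets S q"
  proof (intro subset_antisym subsetI)
    fix X assume X: "X \<in> invariant_subsets (insert x S) q"
    have "X - {x} \<in> invariant_subsets S q"
      using X qx by (auto simp: invariant_subsets_def)
    then show "X \<in> invariant_subsets S q \<union> insert x ` invariant_subsets S q"
      by (cases "x \<in> X") (auto intro!: rev_image_eqI)
  next
    fix X assume "X \<in> invariant_subsets S q \<union> insert x ` invariant_subsets S q"
    then show "X \<in> invariant_subsets (insert x S) q"
      using qx by (auto simp: invariant_subsets_def)
  qed
  have fin': "finite (invariant_subsets S q)" using fin by (simp add: invariant_subsets_def)
  have "inj_on (insert x) (invariant_subsets S q)"
    using x by (auto simp: invariant_subsets_def inj_on_def)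
  moreover have "invariant_subsets S q \<inter> insert x ` invariant_subsets S q = {}"
    using x by (auto simp: invariant_subsets_def)
  ultimately show ?thesis
    unfolding eq using fin' by (simp add: card_Un_disjoint card_image)
qed

text \<open>The point x enters the cycle of j just before j, so its membership must agree with that
  of j. This includes the case that q fixes j.\<close>

lemma card_invariant_subsets_extend:
  assumes x: "x \<notin> S" and j: "j \<in> S" and q: "q permutes S"
  shows "card (invariant_subsets (insert x S) (transpose x j \<circ> q)) = card (invariant_subsets S q)"
proof -
  have qx: "q y = x \<longleftrightarrow> y = x" for y
    using permutes_not_in[OF q x] permutes_inj[OF q] by (metis injD)
  obtain i where i: "q i = j" using permutes_surj[OF q] by (metis surjD)
  have qj: "q y = j \<longleftrightarrow> y = i" for y using i permutes_inj[OF q] by (metis injD)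
  have xj: "x \<noteq> j" "x \<noteq> i" using x j i qx by metis+
  have T: "(transpose x j \<circ> q) y = (if y = x then j else if y = i then x else q y)" for y
    using qx qj xj by (auto simp: transpose_def)
  have inv: "X \<in> invariant_subsets (insert x S) (transpose x j \<circ> q) \<longleftrightarrow>
      X \<subseteq> insert x S \<and> (j \<in> X \<longleftrightarrow> x \<in> X) \<and> (x \<in> X \<longleftrightarrow> i \<in> X) \<and>
        (\<forall>y. y \<noteq> x \<and> y \<noteq> i \<longrightarrow> (q y \<in> X \<longleftrightarrow> y \<in> X))" for X
    unfolding invariant_subsets_def T using xj by (auto split: if_splits)
  have "bij_betw (\<lambda>X. X - {x}) (invariant_subsets (insert x S) (transpose x j \<circ> q)) (invariant_subsets S q)"
  proof (rule bij_betwI[where g = "\<lambda>Y. if j \<in> Y then insert x Y else Y"])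
    show "(\<lambda>X. X - {x}) \<in> invariant_subsets (insert x S) (transpose x j \<circ> q)
        \<rightarrow> invariant_subsets S q"
    proof
      fix X assume X: "X \<in> invariant_subsets (insert x S) (transpose x j \<circ> q)"
      have "q y \<in> X - {x} \<longleftrightarrow> y \<in> X - {x}" for y
      proof -
        consider "y = x" | "y = i" | "y \<noteq> x" "y \<noteq> i" by blast
        then show ?thesis using X xj qx i unfolding inv by cases auto
      qed
      then show "X - {x} \<in> invariant_subsets S q"
        using X unfolding inv by (auto simp: invariant_subsets_def)
    qed
    show "(\<lambda>Y. if j \<in> Y then insert x Y else Y) \<in> invariant_subsets S q \<rightarrow>
        invariant_subsets (insert x S) (transpose x j \<circ> q)"
    proof
      fix Y assume Y: "Y \<in> invariant_subsets S q"
      have "j \<in> Y \<longleftrightarrow> i \<in> Y" using Y i by (auto simp: invariant_subsets_def)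
      moreover have "x \<notin> Y" using Y x by (auto simp: invariant_subsets_def)
      ultimately show
          "(if j \<in> Y then insert x Y else Y) \<in> invariant_subsets (insert x S) (transpose x j \<circ> q)"
        using Y xj qx unfolding inv by (auto simp: invariant_subsets_def)
    qed
  next
    fix X assume "X \<in> invariant_subsets (insert x S) (transpose x j \<circ> q)"
    then show "(if j \<in> X - {x} then insert x (X - {x}) else X - {x}) = X"
      using xj unfolding inv by auto
  next
    fix Y assume "Y \<in> invariant_subsets S q"
    then show "(if j \<in> Y then insert x Y else Y) - {x} = Y"
      using x by (auto simp: invariant_subsets_def)
  qed
  then show ?thesis by (rule bij_betw_same_card)
qed

text \<open>A new point is fixed or enters a cycle at one of \<open>card S\<close> places, which is
  the Stirling recurrence. A new fixed point doubles the argument of g, hence g is generalised in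
  the induction.\<close>

lemma sum_permutes_card_invariant_subsets:
  fixes g :: "nat \<Rightarrow> nat"
  assumes "finite S"
  shows "(\<Sum>\<sigma> | \<sigma> permutes S. g (card (invariant_subsets S \<sigma>)))
    = (\<Sum>k\<le>card S. stirling (card S) k * g (2 ^ k))"
  using assms
proof (induction S arbitrary: g rule: finite_induct)
  case empty
  have "invariant_subsets {} \<sigma> = {{}}" for \<sigma> :: "'a \<Rightarrow> 'a" by (auto simp: invariant_subsets_def)
  then show ?case by simp
next
  case (insert x S)
  define m where "m = card S"
  have "(\<Sum>\<sigma> | \<sigma> permutes insert x S. g (card (invariant_subsets (insert x S) \<sigma>)))
     = (\<Sum>b\<in>insert x S. \<Sum>q | q permutes S. g (card (invariant_subsets (insert x S) (transpose x b \<circ> q))))"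
    by (rule sum_over_permutations_insert[OF insert.hyps])
  also have "\<dots> = (\<Sum>q | q permutes S. g (2 * card (invariant_subsets S q)))
      + (\<Sum>b\<in>S. \<Sum>q | q permutes S. g (card (invariant_subsets S q)))"
    using insert.hyps by (simp add: card_invariant_subsets_fixed card_invariant_subsets_extend)
  also have "\<dots> = (\<Sum>k\<le>m. stirling m k * g (2 ^ Suc k)) + m * (\<Sum>k\<le>m. stirling m k * g (2 ^ k))"
    using insert.IH[of g] insert.IH[of "\<lambda>c. g (2 * c)"] by (simp add: m_def)
  \<comment> \<open>The added term vanishes since \<open>stirling m (Suc m) = 0\<close>. After the
    shift so does the term at 0, because \<open>stirling m 0 = 0\<close> or m = 0.\<close>
  also have "m * (\<Sum>k\<le>m. stirling m k * g (2 ^ k)) = m * (\<Sum>k\<le>Suc m. stirling m k * g (2 ^ k))"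
    by simp
  also have "\<dots> = (\<Sum>k\<le>m. m * stirling m (Suc k) * g (2 ^ Suc k))"
    unfolding sum.atMost_Suc_shift by (cases m) (simp_all add: sum_distrib_left algebra_simps)
  also have "(\<Sum>k\<le>m. stirling m k * g (2 ^ Suc k)) + (\<Sum>k\<le>m. m * stirling m (Suc k) * g (2 ^ Suc k))
      = (\<Sum>k\<le>m. stirling (Suc m) (Suc k) * g (2 ^ Suc k))"
    by (simp add: sum.distrib[symmetric] algebra_simps)
  also have "\<dots> = (\<Sum>k\<le>Suc m. stirling (Suc m) k * g (2 ^ k))"
    unfolding sum.atMost_Suc_shift by simp
  finally show ?case using insert.hyps by (simp add: m_def)
qed

section \<open>Counting isomorphism classes\<close>

text \<open>Double counting of the pairs with \<open>act g x = x\<close>: by the orbit-stabiliser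
  relation each orbit contributes \<open>card G\<close>.\<close>

lemma burnside:
  fixes act :: "'g \<Rightarrow> 'x \<Rightarrow> 'x"
  assumes fin: "finite G" "finite X"
    and closed: "\<And>g x. g \<in> G \<Longrightarrow> x \<in> X \<Longrightarrow> act g x \<in> X"
    and one: "e \<in> G" "\<And>x. act e x = x"
    and mult: "\<And>g h. g \<in> G \<Longrightarrow> h \<in> G \<Longrightarrow> m g h \<in> G"
      "\<And>g h x. g \<in> G \<Longrightarrow> h \<in> G \<Longrightarrow> act (m g h) x = act g (act h x)"
    and inj: "\<And>g. g \<in> G \<Longrightarrow> inj_on (m g) G"
    and inv: "\<And>g. g \<in> G \<Longrightarrow> \<exists>h\<in>G. \<forall>x. act h (act g x) = x"
  shows "card ((\<lambda>x. (\<lambda>g. act g x) ` G) ` X) * card G = (\<Sum>g\<in>G. card {x \<in> X. act g x = x})"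
proof -
  define orb where "orb x = (\<lambda>g. act g x) ` G" for x
  define st where "st x = card {g \<in> G. act g x = x}" for x
  have self: "x \<in> orb x" for x using one unfolding orb_def by (metis image_eqI)
  have sub: "orb y \<subseteq> orb x" if "y \<in> orb x" for x y
    using that mult unfolding orb_def by clarsimp (metis image_eqI)
  have sym: "x \<in> orb y" if y: "y \<in> orb x" for x y
  proof -
    obtain g where g: "g \<in> G" "y = act g x" using y by (auto simp: orb_def)
    obtain h where "h \<in> G" "act h (act g x) = x" using inv[OF g(1)] by blast
    then show ?thesis unfolding g(2) orb_def by (intro image_eqI[of _ _ h]) simp_all
  qed
  have orb_eq: "orb y = orb x" if "y \<in> orb x" for x y
    using that sub sym by blast
  have fin_orb: "finite (orb x)" for x using fin by (simp add: orb_def)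
  have orb_st: "card (orb x) * st x = card G" for x
  proof -
    \<comment> \<open>Left translation by g sends the stabiliser of x into the elements taking x to
      y, and translation by h sends them back; both are injective.\<close>
    have "card {g \<in> G. act g x = y} = st x" if y: "y \<in> orb x" for y
    proof -
      obtain g where g: "g \<in> G" "y = act g x" using y by (auto simp: orb_def)
      obtain h where h: "h \<in> G" "\<And>z. act h (act g z) = z" using inv g by blast
      have "m g ` {k \<in> G. act k x = x} \<subseteq> {k \<in> G. act k x = y}" using g mult by auto
      moreover have "inj_on (m g) {k \<in> G. act k x = x}" using inj[OF g(1)]
          by (rule inj_on_subset) auto
      ultimately have 1: "st x \<le> card {k \<in> G. act k x = y}"
        unfolding st_def using fin(1) by (intro card_inj_on_le[of "m g"]) simp_all
      have "m h ` {k \<in> G. act k x = y} \<subseteq> {k \<in> G. act k x = x}" using g h mult by auto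
      moreover have "inj_on (m h) {k \<in> G. act k x = y}" using inj[OF h(1)]
          by (rule inj_on_subset) auto
      ultimately have "card {k \<in> G. act k x = y} \<le> st x"
        unfolding st_def using fin(1) by (intro card_inj_on_le[of "m h"]) simp_all
      with 1 show ?thesis by simp
    qed
    then have "card (orb x) * st x = (\<Sum>y\<in>orb x. card {g \<in> G. act g x = y})" by simp
    also have "\<dots> = card G"
      using sum.group[OF fin(1) fin_orb, of "\<lambda>g. act g x" x "\<lambda>_. 1::nat"] by (simp add: orb_def)
    finally show ?thesis .
  qed
  have class_sum: "(\<Sum>y\<in>orb x. st y) = card G" for x
  proof -
    have "st y = st x" if "y \<in> orb x" for y
    proof -
      have "card (orb x) > 0" using self fin_orb by (metis card_gt_0_iff empty_iff)
      \<comment> \<open>Points of one orbit have the same orbit, so \<open>orb_st\<close> gives them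
        stabilisers of equal size.\<close>
      then show ?thesis using orb_st[of x] orb_st[of y] orb_eq[OF that]
          by (metis mult_cancel1 less_irrefl)
    qed
    then show ?thesis using orb_st[of x] by simp
  qed
  have "(\<Sum>g\<in>G. card {x \<in> X. act g x = x}) = (\<Sum>g\<in>G. \<Sum>x\<in>X. if act g x = x then 1 else 0)"
    using fin by (simp add: sum.If_cases Int_def)
  also have "\<dots> = (\<Sum>x\<in>X. st x)"
    unfolding st_def using fin by (subst sum.swap) (simp add: sum.If_cases Int_def)
  also have "\<dots> = (\<Sum>x\<in>\<Union> (orb ` X). st x)"
  proof -
    have "X = \<Union> (orb ` X)" using self closed by (auto simp: orb_def)
    then show ?thesis by simp
  qed
  also have "\<dots> = (\<Sum>C\<in>orb ` X. \<Sum>x\<in>C. st x)"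
  proof -
    have "\<forall>C\<in>orb ` X. finite C" using fin_orb by auto
    moreover have "\<forall>A\<in>orb ` X. \<forall>B\<in>orb ` X. A \<noteq> B \<longrightarrow> A \<inter> B = {}"
    proof (clarsimp, rule ccontr)
      fix x y assume ne: "orb x \<noteq> orb y" and "orb x \<inter> orb y \<noteq> {}"
      then obtain z where "z \<in> orb x" "z \<in> orb y" by blast
      then show False using orb_eq ne by metis
    qed
    ultimately show ?thesis by (simp add: sum.Union_disjoint)
  qed
  also have "\<dots> = (\<Sum>C\<in>orb ` X. card G)" using class_sum by (intro sum.cong) auto
  finally show ?thesis by (simp add: orb_def)
qed

section \<open>Fixed graphs as colourings by columns\<close>

definition column :: "('a \<times> 'b) set \<Rightarrow> 'b \<Rightarrow> 'a set" where
  "column E y = {x. (x, y) \<in> E}"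

lemma card_fixed_graphs_le:
  fixes S :: "'a set" and J :: "'b set"
  assumes fin: "finite S" "finite J" and \<sigma>: "\<sigma> permutes S" and \<tau>: "\<tau> permutes J"
  shows "card {E \<in> Pow (S \<times> J). map_prod \<sigma> \<tau> ` E = E}
    \<le> card (cycle_colourings (invariant_subsets S \<sigma>) (Pow S) J \<tau>)"
proof -
  have perm: "permutation \<tau>" using \<tau> fin(2) by (auto simp: permutation_permutes)
  have \<tau>J: "\<tau> y \<in> J" if "y \<in> J" for y using permutes_in_image[OF \<tau>] that by simp
  \<comment> \<open>Keeping only the column at one representative of each cycle of \<open>\<tau>\<close> loses no information.\<close>
  define rep where "rep y = (SOME w. w \<in> orbit \<tau> y)" for y
  have rep_in: "rep y \<in> orbit \<tau> y" for y
    unfolding rep_def using orbit_nonempty[of \<tau> y] by (metis some_in_eq)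
  have rep_step: "rep (\<tau> y) = rep y" for y
    unfolding rep_def permutation_orbit_step[OF perm] ..
  have rep_fixed: "rep y = y" if "\<tau> y = y" for y
    using rep_in[of y] that by (metis orbit_eq_singleton_iff singletonD)
  have col: "\<sigma> x \<in> column E (\<tau> y) \<longleftrightarrow> x \<in> column E y" if "map_prod \<sigma> \<tau> ` E = E" for E x y
  proof -
    have "inj (map_prod \<sigma> \<tau>)"
      using permutes_inj[OF \<sigma>] permutes_inj[OF \<tau>] by (rule prod.inj_map)
    then have "map_prod \<sigma> \<tau> (x, y) \<in> map_prod \<sigma> \<tau> ` E \<longleftrightarrow> (x, y) \<in> E" by (rule inj_image_mem_iff)
    then show ?thesis using that by (simp add: column_def)
  qed
  define \<Phi> where "\<Phi> E = restrict (\<lambda>y. column E (rep y)) J" for E :: "('a \<times> 'b) set"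
  have "\<Phi> ` {E \<in> Pow (S \<times> J). map_prod \<sigma> \<tau> ` E = E}
      \<subseteq> cycle_colourings (invariant_subsets S \<sigma>) (Pow S) J \<tau>"
  proof clarify
    fix E assume E: "E \<subseteq> S \<times> J" "map_prod \<sigma> \<tau> ` E = E"
    have sub: "column E y \<subseteq> S" for y using E(1) by (auto simp: column_def)
    have "column E y \<in> invariant_subsets S \<sigma>" if "\<tau> y = y" for y
      using sub col[OF E(2), of _ y] that by (simp add: invariant_subsets_def)
    then show "\<Phi> E \<in> cycle_colourings (invariant_subsets S \<sigma>) (Pow S) J \<tau>"
      using sub rep_fixed by (auto simp: cycle_colourings_def \<Phi>_def \<tau>J rep_step)
  qed
  moreover have "inj_on \<Phi> {E \<in> Pow (S \<times> J). map_prod \<sigma> \<tau> ` E = E}"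
  proof (rule inj_onI, clarify)
    fix E E' assume E: "E \<subseteq> S \<times> J" "map_prod \<sigma> \<tau> ` E = E"
      and E': "E' \<subseteq> S \<times> J" "map_prod \<sigma> \<tau> ` E' = E'" and eq: "\<Phi> E = \<Phi> E'"
    have step: "column E (\<tau> w) = column E' (\<tau> w) \<longleftrightarrow> column E w = column E' w" for w
    proof
      assume "column E (\<tau> w) = column E' (\<tau> w)"
      then show "column E w = column E' w"
        using col[OF E(2), of _ w] col[OF E'(2), of _ w] by blast
    next
      assume eq: "column E w = column E' w"
      have "x \<in> column E (\<tau> w) \<longleftrightarrow> x \<in> column E' (\<tau> w)" for x
      proof -
        obtain x' where "x = \<sigma> x'" using permutes_surj[OF \<sigma>] by (metis surjD)
        then show ?thesis using col[OF E(2), of x' w] col[OF E'(2), of x' w] eq by simp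
      qed
      then show "column E (\<tau> w) = column E' (\<tau> w)" by blast
    qed
    have orb: "column E w = column E' w \<longleftrightarrow> column E y = column E' y" if "w \<in> orbit \<tau> y" for w y
      using that by induction (simp_all add: step)
    have "column E y = column E' y" if "y \<in> J" for y
    proof -
      have "column E (rep y) = column E' (rep y)"
        using fun_cong[OF eq, of y] that by (simp add: \<Phi>_def)
      then show ?thesis using orb[OF rep_in] by simp
    qed
    then show "E = E'" using E(1) E'(1) by (fastforce simp: column_def)
  qed
  moreover have "finite (cycle_colourings (invariant_subsets S \<sigma>) (Pow S) J \<tau>)"
    unfolding cycle_colourings_def using fin
        by (intro finite_Collect_conjI disjI1) (auto intro: finite_PiE)
  ultimately show ?thesis by (intro card_inj_on_le)
qed

text \<open>For \<sigma> = id every subset is invariant, and a graph with columns constant on the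
  cycles of \<tau> is fixed.\<close>

lemma card_fixed_graphs_id_ge:
  assumes fin: "finite S" "finite J" and \<tau>: "\<tau> permutes J"
  shows "card (cycle_colourings (Pow S) (Pow S) J \<tau>)
      \<le> card {E \<in> Pow (S \<times> J). map_prod id \<tau> ` E = E}"
proof -
  define \<Psi> where "\<Psi> f = {(x, y). y \<in> J \<and> x \<in> f y}" for f :: "'b \<Rightarrow> 'a set"
  have "\<Psi> ` cycle_colourings (Pow S) (Pow S) J \<tau> \<subseteq> {E \<in> Pow (S \<times> J). map_prod id \<tau> ` E = E}"
  proof clarify
    fix f assume f: "f \<in> cycle_colourings (Pow S) (Pow S) J \<tau>"
    have sub: "\<Psi> f \<subseteq> S \<times> J" using f by (auto simp: \<Psi>_def cycle_colourings_def)
    have "map_prod id \<tau> ` \<Psi> f \<subseteq> \<Psi> f"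
      using f permutes_in_image[OF \<tau>] by (auto simp: \<Psi>_def cycle_colourings_def)
    moreover have "finite (\<Psi> f)" using sub fin by (meson finite_SigmaI finite_subset)
    moreover have "inj_on (map_prod id \<tau>) (\<Psi> f)"
      using prod.inj_map[OF inj_on_id permutes_inj[OF \<tau>]] by (rule inj_on_subset) simp
    ultimately have "map_prod id \<tau> ` \<Psi> f = \<Psi> f" by (intro endo_inj_surj)
    then show "\<Psi> f \<in> Pow (S \<times> J) \<and> map_prod id \<tau> ` \<Psi> f = \<Psi> f" using sub by simp
  qed
  moreover have "inj_on \<Psi> (cycle_colourings (Pow S) (Pow S) J \<tau>)"
  proof (rule inj_onI)
    fix f g assume f: "f \<in> cycle_colourings (Pow S) (Pow S) J \<tau>"
      and g: "g \<in> cycle_colourings (Pow S) (Pow S) J \<tau>" and eq: "\<Psi> f = \<Psi> g"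
    have fg: "f \<in> J \<rightarrow>\<^sub>E Pow S" "g \<in> J \<rightarrow>\<^sub>E Pow S" using f g by (auto simp: cycle_colourings_def)
    show "f = g"
    proof (rule PiE_ext[OF fg])
      fix y assume "y \<in> J"
      then show "f y = g y" using eq unfolding \<Psi>_def by blast
    qed
  qed
  moreover have "finite {E \<in> Pow (S \<times> J). map_prod id \<tau> ` E = E}" using fin by simp
  ultimately show ?thesis by (intro card_inj_on_le)
qed

definition iso_class :: "'a set \<Rightarrow> 'b set \<Rightarrow> ('a \<times> 'b) set \<Rightarrow> ('a \<times> 'b) set set" where
  "iso_class S J E = (\<lambda>(\<sigma>, \<tau>). map_prod \<sigma> \<tau> ` E) ` ({\<sigma>. \<sigma> permutes S} \<times> {\<tau>. \<tau> permutes J})"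

lemma iso_class_iff:
  "E' \<in> iso_class S J E \<longleftrightarrow> (\<exists>\<sigma> \<tau>. \<sigma> permutes S \<and> \<tau> permutes J \<and> E' = map_prod \<sigma> \<tau> ` E)"
  by (auto simp: iso_class_def)

lemma iso_class_self: "E \<in> iso_class S J E"
  unfolding iso_class_iff by (intro exI[of _ id]) (auto simp: permutes_id map_prod.id)

lemma card_iso_classes_burnside:
  assumes "finite S" "finite J"
  shows "card (iso_class S J ` Pow (S \<times> J)) * (fact (card S) * fact (card J)) =
    (\<Sum>\<sigma> | \<sigma> permutes S. \<Sum>\<tau> | \<tau> permutes J. card {E \<in> Pow (S \<times> J). map_prod \<sigma> \<tau> ` E = E})"
proof -
  let ?G = "{\<sigma>. \<sigma> permutes S} \<times> {\<tau>. \<tau> permutes J}"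
  let ?act = "\<lambda>(\<sigma>, \<tau>) E. map_prod \<sigma> \<tau> ` E"
  let ?m = "\<lambda>(\<sigma>, \<tau>) (\<sigma>', \<tau>'). (\<sigma> \<circ> \<sigma>', \<tau> \<circ> \<tau>')"
  have "card ((\<lambda>E. (\<lambda>g. ?act g E) ` ?G) ` Pow (S \<times> J)) * card ?G =
      (\<Sum>g\<in>?G. card {E \<in> Pow (S \<times> J). ?act g E = E})"
  proof (rule burnside[where e = "(id, id)" and m = ?m])
    show "finite ?G" "finite (Pow (S \<times> J))" using assms by (auto intro: finite_permutations)
  next
    fix g :: "('a \<Rightarrow> 'a) \<times> ('b \<Rightarrow> 'b)" and E assume "g \<in> ?G" "E \<in> Pow (S \<times> J)"
    then show "?act g E \<in> Pow (S \<times> J)" by (auto simp: permutes_in_image)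
  next
    show "(id, id) \<in> ?G" by (simp add: permutes_id)
  next
    fix E :: "('a \<times> 'b) set" show "?act (id, id) E = E" by (simp add: map_prod.id)
  next
    fix g h :: "('a \<Rightarrow> 'a) \<times> ('b \<Rightarrow> 'b)" assume "g \<in> ?G" "h \<in> ?G"
    then show "?m g h \<in> ?G" by (auto intro: permutes_compose)
  next
    fix g h :: "('a \<Rightarrow> 'a) \<times> ('b \<Rightarrow> 'b)" and E :: "('a \<times> 'b) set"
    show "?act (?m g h) E = ?act g (?act h E)"
      by (auto simp: image_image map_prod_def split_beta split: prod.splits)
  next
    fix g :: "('a \<Rightarrow> 'a) \<times> ('b \<Rightarrow> 'b)" assume g: "g \<in> ?G"
    obtain \<sigma> \<tau> where st: "g = (\<sigma>, \<tau>)" "\<sigma> permutes S" "\<tau> permutes J" using g by auto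
    show "inj_on (?m g) ?G"
      using permutes_inj[OF st(2)] permutes_inj[OF st(3)]
      by (auto simp: st(1) inj_on_def fun_eq_iff)
    show "\<exists>h\<in>?G. \<forall>E. ?act h (?act g E) = E"
    proof (intro bexI[of _ "(inv \<sigma>, inv \<tau>)"] allI)
      show "(inv \<sigma>, inv \<tau>) \<in> ?G" using st by (simp add: permutes_inv)
      show "?act (inv \<sigma>, inv \<tau>) (?act g E) = E" for E
        using permutes_inverses[OF st(2)] permutes_inverses[OF st(3)]
        by (simp add: st(1) image_image map_prod_def split_beta)
    qed
  qed
  then show ?thesis
    using assms by (simp add: iso_class_def[abs_def] card_cartesian_product card_permutations
        sum.cartesian_product split_beta case_prod_unfold)
qed

lemma card_iso_classes_ge:
  assumes "finite S" "finite J"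
  shows "pochhammer (2 ^ card S) (card J)
      \<le> card (iso_class S J ` Pow (S \<times> J)) * (fact (card S) * fact (card J))"
proof -
  let ?F = "\<lambda>\<sigma>. \<Sum>\<tau> | \<tau> permutes J. card {E \<in> Pow (S \<times> J). map_prod \<sigma> \<tau> ` E = E}"
  have "pochhammer (2 ^ card S) (card J)
      = (\<Sum>\<tau> | \<tau> permutes J. card (cycle_colourings (Pow S) (Pow S) J \<tau>))"
    using assms by (simp add: sum_card_cycle_colourings card_Pow cycle_weight_same)
  also have "\<dots> \<le> ?F id"
    using assms by (intro sum_mono card_fixed_graphs_id_ge) auto
  also have "\<dots> \<le> (\<Sum>\<sigma> | \<sigma> permutes S. ?F \<sigma>)"
    using assms permutes_id by (intro member_le_sum[of id _ ?F]) (simp_all add: finite_permutations)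
  finally show ?thesis using card_iso_classes_burnside[OF assms] by simp
qed

text \<open>Induction from r = n + 1: each step multiplies every summand by at most
  \<open>2 ^ n + r\<close>, exactly the growth of the Pochhammer symbol.\<close>

lemma stirling_cycle_weight_le:
  assumes "r \<ge> Suc n"
  shows "(\<Sum>k\<le>n. stirling n k * cycle_weight (2 ^ k) (2 ^ n) r) \<le> 2 * pochhammer (2 ^ n) r"
  using assms
proof (induction r rule: nat_induct_at_least)
  case base
  then show ?case
    using stirling_cycle_weight_le_small stirling_cycle_weight_le_large by (cases "n < 15") auto
next
  case (Suc r)
  have "(\<Sum>k\<le>n. stirling n k * cycle_weight (2 ^ k) (2 ^ n) (Suc r))
      \<le> (\<Sum>k\<le>n. stirling n k * ((2 ^ n + r) * cycle_weight (2 ^ k) (2 ^ n) r))"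
    by (intro sum_mono mult_left_mono cycle_weight_Suc_le) auto
  also have "\<dots> = (2 ^ n + r) * (\<Sum>k\<le>n. stirling n k * cycle_weight (2 ^ k) (2 ^ n) r)"
    by (simp add: sum_distrib_left mult_ac)
  also have "\<dots> \<le> (2 ^ n + r) * (2 * pochhammer (2 ^ n) r)"
    using Suc by (intro mult_left_mono) auto
  finally show ?case by (simp add: pochhammer_Suc mult_ac)
qed

lemma card_iso_classes_le:
  assumes "finite S" "finite J" "card S < card J"
  shows "card (iso_class S J ` Pow (S \<times> J)) * (fact (card S) * fact (card J))
      \<le> 2 * pochhammer (2 ^ card S) (card J)"
proof -
  have "card (iso_class S J ` Pow (S \<times> J)) * (fact (card S) * fact (card J)) \<le>
      (\<Sum>\<sigma> | \<sigma> permutes S. \<Sum>\<tau> | \<tau> permutes J. card (cycle_colourings (invariant_subsets S \<sigma>) (Pow S) J \<tau>))"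
    unfolding card_iso_classes_burnside[OF assms(1,2)]
    using assms by (intro sum_mono card_fixed_graphs_le) auto
  also have "\<dots> = (\<Sum>\<sigma> | \<sigma> permutes S. cycle_weight (card (invariant_subsets S \<sigma>)) (2 ^ card S) (card J))"
  proof (rule sum.cong)
    fix \<sigma>
    have "invariant_subsets S \<sigma> \<subseteq> Pow S" by (auto simp: invariant_subsets_def)
    then show "(\<Sum>\<tau> | \<tau> permutes J. card (cycle_colourings (invariant_subsets S \<sigma>) (Pow S) J \<tau>)) =
        cycle_weight (card (invariant_subsets S \<sigma>)) (2 ^ card S) (card J)"
      using sum_card_cycle_colourings[of J "Pow S" "invariant_subsets S \<sigma>"] assms
          by (simp add: card_Pow)
  qed simp
  also have "\<dots> = (\<Sum>k\<le>card S. stirling (card S) k * cycle_weight (2 ^ k) (2 ^ card S) (card J))"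
    using assms by (intro sum_permutes_card_invariant_subsets)
  also have "\<dots> \<le> 2 * pochhammer (2 ^ card S) (card J)"
    using assms by (intro stirling_cycle_weight_le) auto
  finally show ?thesis .
qed

lemma pochhammer_eq_fact_mult_binomial:
  fixes N :: nat
  assumes "N \<ge> 1"
  shows "pochhammer N r = fact r * ((r + N - 1) choose r)"
proof -
  have "real (pochhammer N r) = real (fact r * ((r + N - 1) choose r))"
    using assms
    by (simp add: binomial_gbinomial gbinomial_pochhammer' pochhammer_of_nat[symmetric] of_nat_diff)
  then show ?thesis using of_nat_eq_iff by blast
qed

section \<open>Graphs without isolated left vertices\<close>

lemma iso_class_eq:
  assumes "E' \<in> iso_class S J E"
  shows "iso_class S J E' = iso_class S J E"
proof -
  have sub: "iso_class S J E' \<subseteq> iso_class S J E" if E': "E' \<in> iso_class S J E" for E E'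
  proof
    fix F assume "F \<in> iso_class S J E'"
    then obtain \<sigma>' \<tau>' where 1: "\<sigma>' permutes S" "\<tau>' permutes J" "F = map_prod \<sigma>' \<tau>' ` E'"
      by (auto simp: iso_class_iff)
    obtain \<sigma> \<tau> where 2: "\<sigma> permutes S" "\<tau> permutes J" "E' = map_prod \<sigma> \<tau> ` E"
      using E' by (auto simp: iso_class_iff)
    have "F = map_prod (\<sigma>' \<circ> \<sigma>) (\<tau>' \<circ> \<tau>) ` E"
      using 1 2 by (simp add: image_comp map_prod.comp)
    then show "F \<in> iso_class S J E"
      using 1 2 by (auto simp: iso_class_iff intro: permutes_compose)
  qed
  obtain \<sigma> \<tau> where 2: "\<sigma> permutes S" "\<tau> permutes J" "E' = map_prod \<sigma> \<tau> ` E"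
    using assms by (auto simp: iso_class_iff)
  have "map_prod (inv \<sigma>) (inv \<tau>) ` E' = E"
    using 2 by (simp add: image_comp map_prod.comp permutes_inv_o map_prod.id)
  then have "E \<in> iso_class S J E'"
    using permutes_inv[OF 2(1)] permutes_inv[OF 2(2)] unfolding iso_class_iff by metis
  then show ?thesis using sub[OF assms] sub by blast
qed

text \<open>On \<open>A\<close> the map f factors through g. Used to compare the numbers of classes
  of two equivalences.\<close>

lemma card_image_le_card_image:
  assumes "finite A" and "\<And>a b. a \<in> A \<Longrightarrow> b \<in> A \<Longrightarrow> g a = g b \<Longrightarrow> f a = f b"
  shows "card (f ` A) \<le> card (g ` A)"
proof -
  have "f ` A \<subseteq> (\<lambda>c. f (inv_into A g c)) ` g ` A"
  proof
    fix c assume "c \<in> f ` A"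
    then obtain a where a: "a \<in> A" "c = f a" by auto
    then have "f (inv_into A g (g a)) = f a"
      by (intro assms(2)) (auto simp: inv_into_into f_inv_into_f)
    then show "c \<in> (\<lambda>c. f (inv_into A g c)) ` g ` A" using a by force
  qed
  then show ?thesis using assms(1) by (simp add: surj_card_le)
qed

lemma iso_class_restrict:
  assumes x: "x \<notin> S" and E: "E \<subseteq> S \<times> J" "E' \<subseteq> S \<times> J"
    and iso: "E' \<in> iso_class (insert x S) J E"
  shows "E' \<in> iso_class S J E"
proof -
  obtain \<sigma> \<tau> where st: "\<sigma> permutes insert x S" "\<tau> permutes J" "E' = map_prod \<sigma> \<tau> ` E"
    using iso by (auto simp: iso_class_iff)
  \<comment> \<open>Bypassing \<open>x\<close> changes \<open>\<sigma>\<close> only at \<open>x\<close> and its preimage, which are isolated in \<open>E\<close>.\<close>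
  let ?\<sigma>' = "transpose x (\<sigma> x) \<circ> \<sigma>"
  have "map_prod \<sigma> \<tau> e = map_prod ?\<sigma>' \<tau> e" if "e \<in> E" for e
  proof -
    obtain u v where e: "e = (u, v)" by (cases e)
    have "u \<noteq> x" using that E(1) x e by auto
    then have "\<sigma> u \<noteq> \<sigma> x" using permutes_inj[OF st(1)] by (metis injD)
    moreover have "(\<sigma> u, \<tau> v) \<in> E'" using that st(3) e by force
    then have "\<sigma> u \<noteq> x" using E(2) x by auto
    ultimately show ?thesis using e by (simp add: transpose_def)
  qed
  then have "E' = map_prod ?\<sigma>' \<tau> ` E" unfolding st(3) by (intro image_cong) auto
  then show ?thesis
    using permutes_insert_lemma[OF st(1)] st(2) unfolding iso_class_iff by blast
qed

definition full_graphs :: "'a set \<Rightarrow> 'b set \<Rightarrow> ('a \<times> 'b) set set" where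
  "full_graphs S J = {E \<in> Pow (S \<times> J). fst ` E = S}"

text \<open>Classes of graphs leaving x isolated differ from the full ones and, by
  \<open>iso_class_restrict\<close>, are at least as many as the classes over S. This is the origin
  of the subtracted term in the theorem.\<close>

lemma card_full_iso_classes_le:
  assumes fin: "finite S" "finite J" and x: "x \<notin> S"
  shows "card (iso_class (insert x S) J ` full_graphs (insert x S) J)
      + card (iso_class S J ` Pow (S \<times> J))
    \<le> card (iso_class (insert x S) J ` Pow (insert x S \<times> J))"
proof -
  let ?c = "iso_class (insert x S) J"
  have "card (iso_class S J ` Pow (S \<times> J)) \<le> card (?c ` Pow (S \<times> J))"
  proof (rule card_image_le_card_image)
    fix E E' assume E: "E \<in> Pow (S \<times> J)" "E' \<in> Pow (S \<times> J)" "?c E = ?c E'"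
    then have "E \<in> ?c E'" using iso_class_self by metis
    then show "iso_class S J E = iso_class S J E'"
      using E by (intro iso_class_eq iso_class_restrict[OF x]) auto
  qed (use fin in simp)
  \<comment> \<open>An isomorphism carries left projections onto each other, but a graph inside
    \<open>S \<times> J\<close> has at most \<open>card S\<close> non-isolated left
    vertices.\<close>
  moreover have "?c ` full_graphs (insert x S) J \<inter> ?c ` Pow (S \<times> J) = {}"
  proof (rule ccontr)
    assume "?c ` full_graphs (insert x S) J \<inter> ?c ` Pow (S \<times> J) \<noteq> {}"
    then obtain E E' where E: "fst ` E = insert x S" "E' \<subseteq> S \<times> J" "?c E = ?c E'"
      by (auto simp: full_graphs_def)
    then have "E \<in> ?c E'" using iso_class_self by metis
    then obtain \<sigma> \<tau> where "E = map_prod \<sigma> \<tau> ` E'" by (auto simp: iso_class_iff)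
    then have "insert x S = \<sigma> ` fst ` E'" using E(1) by (simp add: image_image)
    also have "\<dots> \<subseteq> \<sigma> ` S" using E(2) by auto
    finally have "card (insert x S) \<le> card S"
      using fin(1) by (meson card_image_le card_mono finite_imageI order_trans)
    then show False using fin(1) x by simp
  qed
  ultimately have "card (?c ` full_graphs (insert x S) J) + card (iso_class S J ` Pow (S \<times> J))
      \<le> card (?c ` full_graphs (insert x S) J \<union> ?c ` Pow (S \<times> J))"
    using fin by (subst card_Un_disjoint) (auto simp: full_graphs_def)
  also have "\<dots> \<le> card (?c ` Pow (insert x S \<times> J))"
    using fin by (intro card_mono) (auto simp: full_graphs_def)
  finally show ?thesis .
qed

lemma connected_domain_eq_fst_image:
  assumes "finite I" "finite J" "E \<subseteq> I \<times> J"
  shows "connected_domain I E = fst ` E"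
proof -
  have "finite E" using assms by (meson finite_SigmaI finite_subset)
  then show ?thesis using assms(3) by (force simp: connected_domain_def left_degree_def)
qed

text \<open>Sort the classes by connected domain S. An isomorphism over S fixes the rest of I, hence
  permutes I; full graphs over S share the connected domain S, so isomorphic ones are
  equivalent.\<close>

lemma card_B_x_le:
  assumes fin: "finite I" "finite J"
  shows "card (B_x I J) \<le> (\<Sum>S\<in>Pow I. card (iso_class S J ` full_graphs S J))"
proof -
  let ?R = "left_set_labeled_rel I J"
  let ?c = "\<lambda>E. ?R `` {E}"
  have "B_x I J \<subseteq> (\<Union>S\<in>Pow I. ?c ` full_graphs S J)"
  proof
    fix C assume "C \<in> B_x I J"
    then obtain E where E: "E \<subseteq> I \<times> J" "C = ?c E"
      by (auto simp: B_x_def bipartite_graphs_def quotient_def)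
    then have "fst ` E \<in> Pow I" "E \<in> full_graphs (fst ` E) J" by (force simp: full_graphs_def)+
    then show "C \<in> (\<Union>S\<in>Pow I. ?c ` full_graphs S J)" using E(2) by blast
  qed
  moreover have fin': "finite (full_graphs S J)" if "S \<in> Pow I" for S
  proof -
    have "finite (Pow (S \<times> J))" using fin that by (auto intro: finite_subset)
    then show ?thesis by (rule finite_subset[rotated]) (auto simp: full_graphs_def)
  qed
  ultimately have "card (B_x I J) \<le> card (\<Union>S\<in>Pow I. ?c ` full_graphs S J)"
    using fin by (intro card_mono) auto
  also have "\<dots> \<le> (\<Sum>S\<in>Pow I. card (?c ` full_graphs S J))"
    using fin by (intro card_UN_le) auto
  also have "\<dots> \<le> (\<Sum>S\<in>Pow I. card (iso_class S J ` full_graphs S J))"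
  proof (intro sum_mono card_image_le_card_image)
    fix S E E' assume S: "S \<in> Pow I" and E: "E \<in> full_graphs S J" "E' \<in> full_graphs S J"
      and eq: "iso_class S J E = iso_class S J E'"
    then have "E \<in> iso_class S J E'" using iso_class_self by metis
    then obtain \<sigma> \<tau> where st: "\<sigma> permutes S" "\<tau> permutes J" "E = map_prod \<sigma> \<tau> ` E'"
      by (auto simp: iso_class_iff)
    have sub: "E \<subseteq> I \<times> J" "E' \<subseteq> I \<times> J" using E S by (auto simp: full_graphs_def)
    have "\<sigma> permutes I" using permutes_subset[OF st(1)] S by auto
    moreover have "(x, y) \<in> E' \<longleftrightarrow> (\<sigma> x, \<tau> y) \<in> E" for x y
    proof -
      have "inj (map_prod \<sigma> \<tau>)"
        using permutes_inj[OF st(1)] permutes_inj[OF st(2)] by (rule prod.inj_map)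
      then show ?thesis unfolding st(3)
          using inj_image_mem_iff[of "map_prod \<sigma> \<tau>" "(x, y)" E'] by simp
    qed
    moreover have "connected_domain I E' = connected_domain I E"
      using E sub fin by (simp add: connected_domain_eq_fst_image full_graphs_def)
    ultimately have "left_set_labeled_equivalent I J E' E"
      unfolding left_set_labeled_equivalent_def
      using permutes_imp_bij[OF st(2)] permutes_imp_bij[of \<sigma> I] by blast
    then have "(E', E) \<in> ?R" using sub by (simp add: left_set_labeled_rel_def bipartite_graphs_def)
    then show "?c E = ?c E'" using equiv_class_eq[OF equiv_left_set_labeled_rel] by metis
  qed (use fin' in auto)
  finally show ?thesis .
qed

section \<open>Assembling the bound\<close>

lemma sum_Pow_card:
  fixes h :: "nat \<Rightarrow> real"
  assumes "finite A"
  shows "(\<Sum>S\<in>Pow A. h (card S)) = (\<Sum>i\<le>card A. real (card A choose i) * h i)"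
proof -
  have "(\<Sum>S\<in>Pow A. h (card S)) = (\<Sum>i\<le>card A. \<Sum>S | S \<in> Pow A \<and> card S = i. h (card S))"
    using assms by (intro sum.group[symmetric]) (auto intro: card_mono)
  also have "\<dots> = (\<Sum>i\<le>card A. real (card A choose i) * h i)"
    using assms by (intro sum.cong) (auto simp: n_subsets)
  finally show ?thesis .
qed

lemma card_iso_classes_le_binomial:
  assumes "finite S" "finite J" "card S < card J"
  shows "real (card (iso_class S J ` Pow (S \<times> J)))
    \<le> 2 * real ((card J + 2 ^ card S - 1) choose card J) / fact (card S)"
proof -
  have "card (iso_class S J ` Pow (S \<times> J)) * fact (card S) * fact (card J)
      \<le> 2 * ((card J + 2 ^ card S - 1) choose card J) * fact (card J)"
    using card_iso_classes_le[OF assms] by (simp add: pochhammer_eq_fact_mult_binomial mult_ac)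
  then have "card (iso_class S J ` Pow (S \<times> J)) * fact (card S)
      \<le> 2 * ((card J + 2 ^ card S - 1) choose card J)"
    by simp
  then have "real (card (iso_class S J ` Pow (S \<times> J)) * fact (card S))
      \<le> real (2 * ((card J + 2 ^ card S - 1) choose card J))"
    by (rule of_nat_mono)
  then show ?thesis by (simp add: pos_le_divide_eq)
qed

lemma card_iso_classes_ge_binomial:
  assumes "finite S" "finite J"
  shows "real ((card J + 2 ^ card S - 1) choose card J) / fact (card S)
    \<le> real (card (iso_class S J ` Pow (S \<times> J)))"
proof -
  have "((card J + 2 ^ card S - 1) choose card J) * fact (card J)
      \<le> card (iso_class S J ` Pow (S \<times> J)) * fact (card S) * fact (card J)"
    using card_iso_classes_ge[OF assms] by (simp add: pochhammer_eq_fact_mult_binomial mult_ac)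
  then have "((card J + 2 ^ card S - 1) choose card J)
      \<le> card (iso_class S J ` Pow (S \<times> J)) * fact (card S)"
    by simp
  then have "real ((card J + 2 ^ card S - 1) choose card J)
      \<le> real (card (iso_class S J ` Pow (S \<times> J)) * fact (card S))"
    by (rule of_nat_mono)
  then show ?thesis by (simp add: pos_divide_le_eq)
qed

theorem theorem3:
  fixes I J :: "'v set" and n r :: nat
  assumes "finite I" and "finite J" and "I \<inter> J = {}"
    and "card I = n" and "card J = r"
    and "1 \<le> n" and "n < r"
  shows "real (card (B_x I J)) \<le>
    1 + (\<Sum>i=1..n. real (n choose i) *
      (2 * real ((r + 2 ^ i - 1) choose r) / fact i
        - real ((r + 2 ^ (i - 1) - 1) choose r) / fact (i - 1)))"
proof -
  define h :: "nat \<Rightarrow> real" where "h i = 2 * real ((r + 2 ^ i - 1) choose r) / fact i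
        - real ((r + 2 ^ (i - 1) - 1) choose r) / fact (i - 1)" for i
  have full: "real (card (iso_class S J ` full_graphs S J))
      \<le> (if card S = 0 then 1 else h (card S))"
    if S: "S \<in> Pow I" for S
  proof (cases "S = {}")
    case True
    \<comment> \<open>The empty domain belongs to the edgeless graph alone, which yields the leading
      1.\<close>
    have "full_graphs ({} :: 'v set) J = {{}}" by (auto simp: full_graphs_def)
    then show ?thesis using True by simp
  next
    case False
    \<comment> \<open>Dropping any one vertex x leaves T of size \<open>card S - 1\<close>: the
      upper bound for S, valid as \<open>card S \<le> n < r\<close>, minus the lower bound for T
      gives h.\<close>
    then obtain x T where T: "S = insert x T" "x \<notin> T" by (metis Set.set_insert ex_in_conv)
    have fin: "finite S" "finite T" using S T assms(1) by (auto intro: finite_subset)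
    have "card S \<le> n" using S assms(1,4) card_mono by blast
    then have "real (card (iso_class S J ` Pow (S \<times> J)))
        \<le> 2 * real ((r + 2 ^ card S - 1) choose r) / fact (card S)"
      using card_iso_classes_le_binomial[OF fin(1) assms(2)] assms by simp
    moreover have
        "real ((r + 2 ^ (card S - 1) - 1) choose r) / fact (card S - 1)
        \<le> real (card (iso_class T J ` Pow (T \<times> J)))"
      using card_iso_classes_ge_binomial[OF fin(2) assms(2)] assms T fin by simp
    moreover have
        "real (card (iso_class S J ` full_graphs S J)) + real (card (iso_class T J ` Pow (T \<times> J)))
        \<le> real (card (iso_class S J ` Pow (S \<times> J)))"
      using card_full_iso_classes_le[OF fin(2) assms(2) T(2)] unfolding T(1) of_nat_add[symmetric]
      by (rule of_nat_mono)
    ultimately show ?thesis using False fin by (simp add: h_def)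
  qed
  have "real (card (B_x I J)) \<le> real (\<Sum>S\<in>Pow I. card (iso_class S J ` full_graphs S J))"
    by (rule of_nat_mono[OF card_B_x_le[OF assms(1,2)]])
  also have "\<dots> \<le> (\<Sum>S\<in>Pow I. if card S = 0 then 1 else h (card S))"
    unfolding of_nat_sum by (rule sum_mono[OF full])
  also have "\<dots> = (\<Sum>i\<le>n. real (n choose i) * (if i = 0 then 1 else h i))"
    using sum_Pow_card[OF assms(1), of "\<lambda>i. if i = 0 then 1 else h i"] assms(4) by simp
  also have "\<dots> = 1 + (\<Sum>i=1..n. real (n choose i) * h i)"
    by (simp add: atMost_atLeast0 sum.atLeast_Suc_atMost)
  finally show ?thesis unfolding h_def .
qed

end
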